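(* Let $F(z,w,w')=0$ be an irreducible first order algebraic differential equation of algebraic genus zero and without movable critical point, where $F$ is a polynomial in $w,w'$ with coefficients in $\mathbb{C}(z)$. Suppose that a rational parametrization $x=r_1(t,z)$, $y=r_2(t,z)$ of the curve $F(z,x,y)=0$ is given, with $r_1,r_2$ rational functions in $t$ and $z$ and with $t$ expressible as a rational function of $z,x,y$ on the curve. Then, under the substitution $w=r_1(t,z)$, $w'=r_2(t,z)$, the differential equation for $t$, $$\frac{dt}{dz}=\Big(r_2(t,z)-\frac{\partial r_1}{\partial z}(t,z)\Big)\Big/\frac{\partial r_1}{\partial t}(t,z),$$ is a Riccati equation, i.e. its right-hand side equals $A(z)t^2+B(z)t+C(z)$ for some rational functions $A,B,C\in\mathbb{C}(z)$. Moreover, if $A\not\equiv 0$, then for an appropriate $\beta\in\mathbb{C}(z)$ the changes of variables $t=-u/A(z)$, $u=v+\beta(z)$ transform this equation into a classical Riccati equation $v'+v^2=r(z)$ with $r\in\mathbb{C}(z)$; and if $A\equiv 0$, it is the linear equation $t'=B(z)t+C(z)$.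
   Context: Here $w'=dw/dz$. The equation is called irreducible if $F$ is irreducible as a polynomial in $w,w'$ over $\mathbb{C}(z)$; it is of first order, i.e. $w'$ actually occurs in $F$. The algebraic genus of $F(z,w,w')=0$ is the genus of the curve $F(z,x,y)=0$ with respect to the variables $x=w$ and $y=w'$ (for generic $z$). A rational parametrization of $F(z,x,y)=0$ with the stated inversion property means: $r_1,r_2\in\mathbb{C}(t,z)$ satisfy $F(z,r_1(t,z),r_2(t,z))=0$ identically, and $\mathbb{C}(z)(r_1,r_2)=\mathbb{C}(z)(t)$. A first order algebraic differential equation is said to be without movable critical point if its solutions have no branch points whose position depends on the initial data; equivalently, there is a finite set $S\subset\mathbb{C}$ such that every germ of an analytic solution at a point of $\mathbb{C}\setminus S$ can be continued meromorphically along every path in $\mathbb{C}\setminus S$ (poles are the only singularities which may move with the initial data). *)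

theory Defs
  imports
    "HOL-Complex_Analysis.Complex_Analysis"
    "HOL-Computational_Algebra.Computational_Algebra"
    "HOL-Computational_Algebra.Field_as_Ring"
begin

text \<open>
  Bivariate polynomials are polynomials over polynomials; in \<open>poly2 P x y\<close> the variable \<open>x\<close>
  belongs to the coefficient (inner) ring and \<open>y\<close> is the outer variable.  The following
  orders of variables are used throughout:

  \<^item> \<open>\<complex>(z)\<close> is \<^typ>\<open>complex poly fract\<close>;
  \<^item> \<open>\<complex>(z)[x,y]\<close>, with \<open>x = w\<close> and \<open>y = w'\<close>, is \<^typ>\<open>complex poly fract poly poly\<close>, with
    \<open>x\<close> the inner and \<open>y\<close> the outer variable;
  \<^item> \<open>\<complex>(t,z)\<close> is \<^typ>\<open>complex poly poly fract\<close>, with \<open>z\<close> the inner and \<open>t\<close> the outer variable.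
\<close>

definition poly2 :: "'a::comm_semiring_1 poly poly \<Rightarrow> 'a \<Rightarrow> 'a \<Rightarrow> 'a" where
  "poly2 P x y = poly (poly P [:y:]) x"

definition map_poly2 :: "('a::zero \<Rightarrow> 'b::zero) \<Rightarrow> 'a poly poly \<Rightarrow> 'b poly poly" where
  "map_poly2 h = map_poly (map_poly h)"


section \<open>Rational functions in one and two variables\<close>

text \<open>Evaluation uses the reduced representation; at a pole the value is the dummy value 0.\<close>

definition ratfun_regular :: "complex poly fract \<Rightarrow> complex \<Rightarrow> bool" where
  "ratfun_regular q z \<longleftrightarrow> poly (snd (quot_of_fract q)) z \<noteq> 0"

definition ratfun_eval :: "complex poly fract \<Rightarrow> complex \<Rightarrow> complex" where
  "ratfun_eval q z = poly (fst (quot_of_fract q)) z / poly (snd (quot_of_fract q)) z"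

definition ratfun2_regular :: "complex poly poly fract \<Rightarrow> complex \<Rightarrow> complex \<Rightarrow> bool" where
  "ratfun2_regular q t z \<longleftrightarrow> poly2 (snd (quot_of_fract q)) z t \<noteq> 0"

definition ratfun2_eval :: "complex poly poly fract \<Rightarrow> complex \<Rightarrow> complex \<Rightarrow> complex" where
  "ratfun2_eval q t z = poly2 (fst (quot_of_fract q)) z t / poly2 (snd (quot_of_fract q)) z t"

definition embed_z :: "complex poly fract \<Rightarrow> complex poly poly fract" where
  "embed_z q = Fract [:fst (quot_of_fract q):] [:snd (quot_of_fract q):]"

definition var_t :: "complex poly poly fract" where
  "var_t = to_fract [:0, 1:]"

text \<open>Extension of a derivation \<open>D\<close> to the field of fractions by the quotient rule.\<close>

definition fract_derivation ::
    "('a \<Rightarrow> 'a) \<Rightarrow> 'a::{ring_gcd,idom_divide,semiring_gcd_mult_normalize} fract \<Rightarrow> 'a fract" where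
  "fract_derivation D q =
     (let (a, b) = quot_of_fract q in Fract (D a * b - a * D b) (b * b))"

definition deriv_t :: "complex poly poly fract \<Rightarrow> complex poly poly fract" where
  "deriv_t = fract_derivation pderiv"

definition deriv_z :: "complex poly poly fract \<Rightarrow> complex poly poly fract" where
  "deriv_z = fract_derivation (map_poly pderiv)"


section \<open>The genus of a plane curve\<close>

text \<open>
  Let \<open>f \<in> \<complex>[x,y]\<close> be irreducible and of positive degree in \<open>y\<close>.  Its function field is
  \<open>\<complex>(x)[y]/(f)\<close>.  Elements of the function field are represented by elements of
  \<open>\<complex>(x)[y]\<close>, and uniquely by those of degree less than the degree of \<open>f\<close>.
\<close>

definition curve_poly :: "complex poly poly \<Rightarrow> complex poly fract poly" where
  "curve_poly f = map_poly to_fract f"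

text \<open>
  Places are the normalized discrete valuations of the function field that are trivial on
  \<open>\<complex>\<close>.  The value at the zero element of the function field, mathematically
  \<open>\<infinity>\<close>, is fixed to be 0, so that distinct functions are distinct valuations.
\<close>

definition curve_place :: "complex poly poly \<Rightarrow> (complex poly fract poly \<Rightarrow> int) \<Rightarrow> bool" where
  "curve_place f v \<longleftrightarrow>
     (let m = curve_poly f in
       v 0 = 0 \<and>
       (\<forall>p q. m dvd p - q \<longrightarrow> v p = v q) \<and>
       (\<forall>p q. \<not> m dvd p \<and> \<not> m dvd q \<longrightarrow> v (p * q) = v p + v q) \<and>
       (\<forall>p q. \<not> m dvd p \<and> \<not> m dvd q \<and> \<not> m dvd p + q \<longrightarrow> min (v p) (v q) \<le> v (p + q)) \<and>
       (\<forall>c. c \<noteq> 0 \<longrightarrow> v [:to_fract [:c:]:] = 0) \<and>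
       (\<exists>p. \<not> m dvd p \<and> v p = 1))"

definition curve_divisor ::
    "complex poly poly \<Rightarrow> ((complex poly fract poly \<Rightarrow> int) \<Rightarrow> int) \<Rightarrow> bool" where
  "curve_divisor f D \<longleftrightarrow> finite {v. D v \<noteq> 0} \<and> (\<forall>v. D v \<noteq> 0 \<longrightarrow> curve_place f v)"

text \<open>All places have degree one because the field of constants is \<open>\<complex>\<close>.\<close>

definition divisor_degree :: "((complex poly fract poly \<Rightarrow> int) \<Rightarrow> int) \<Rightarrow> int" where
  "divisor_degree D = (\<Sum>v | D v \<noteq> 0. D v)"

definition riemann_roch_space ::
    "complex poly poly \<Rightarrow> ((complex poly fract poly \<Rightarrow> int) \<Rightarrow> int) \<Rightarrow> complex poly fract poly set" where
  "riemann_roch_space f D =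
     {p. degree p < degree (curve_poly f) \<and> (p \<noteq> 0 \<longrightarrow> (\<forall>v. curve_place f v \<longrightarrow> - D v \<le> v p))}"

definition riemann_roch_dim ::
    "complex poly poly \<Rightarrow> ((complex poly fract poly \<Rightarrow> int) \<Rightarrow> int) \<Rightarrow> nat" where
  "riemann_roch_dim f D =
     vector_space.dim (\<lambda>c p. smult (to_fract [:c:]) p) (riemann_roch_space f D)"

text \<open>The genus is the maximum of \<open>deg D - l(D) + 1\<close> over all divisors \<open>D\<close>.\<close>

definition curve_has_genus :: "complex poly poly \<Rightarrow> nat \<Rightarrow> bool" where
  "curve_has_genus f g \<longleftrightarrow>
     irreducible f \<and> degree f > 0 \<and>
     (\<forall>D. curve_divisor f D \<longrightarrow> divisor_degree D - int (riemann_roch_dim f D) + 1 \<le> int g) \<and>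
     (\<exists>D. curve_divisor f D \<and> divisor_degree D - int (riemann_roch_dim f D) + 1 = int g)"


section \<open>First order algebraic differential equations\<close>

text \<open>The polynomial \<open>F(z,x,y)\<close> in \<open>x\<close> and \<open>y\<close> for a fixed value of \<open>z\<close>.\<close>

definition ode_at :: "complex poly fract poly poly \<Rightarrow> complex \<Rightarrow> complex poly poly" where
  "ode_at F z = map_poly2 (\<lambda>q. ratfun_eval q z) F"

definition first_order :: "complex poly fract poly poly \<Rightarrow> bool" where
  "first_order F \<longleftrightarrow> degree F > 0"

definition has_algebraic_genus :: "complex poly fract poly poly \<Rightarrow> nat \<Rightarrow> bool" where
  "has_algebraic_genus F g \<longleftrightarrow> (\<forall>\<^sub>F z in cofinite. curve_has_genus (ode_at F z) g)"

text \<open>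
  The equation is required on a punctured neighbourhood of \<open>z0\<close> only: at a pole of a coefficient
  of \<open>F\<close> the value of \<open>ode_at\<close> is meaningless, elsewhere this makes no difference by continuity.
\<close>

definition solution_germ ::
    "complex poly fract poly poly \<Rightarrow> (complex \<Rightarrow> complex) \<Rightarrow> complex \<Rightarrow> bool" where
  "solution_germ F w z0 \<longleftrightarrow>
     w analytic_on {z0} \<and> (\<forall>\<^sub>F z in at z0. poly2 (ode_at F z) (w z) (deriv w z) = 0)"

text \<open>
  Meromorphic continuation of the germ of \<open>w\<close> along \<open>\<gamma>\<close>: \<open>f s\<close> represents the
  germ of a meromorphic function at \<open>\<gamma> s\<close>.  Germs of meromorphic functions are compared on punctured
  neighbourhoods, since the value of \<open>f s\<close> at a pole carries no information.
\<close>

definition meromorphic_continuation ::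
    "(complex \<Rightarrow> complex) \<Rightarrow> (real \<Rightarrow> complex) \<Rightarrow> (real \<Rightarrow> complex \<Rightarrow> complex) \<Rightarrow> bool" where
  "meromorphic_continuation w \<gamma> f \<longleftrightarrow>
     (\<forall>\<^sub>F z in at (pathstart \<gamma>). f 0 z = w z) \<and>
     (\<forall>s\<in>{0..1}. f s meromorphic_on {\<gamma> s}) \<and>
     (\<forall>s\<in>{0..1}. \<forall>\<^sub>F s' in at s within {0..1}. \<forall>\<^sub>F z in at (\<gamma> s'). f s' z = f s z)"

definition no_movable_critical_point :: "complex poly fract poly poly \<Rightarrow> bool" where
  "no_movable_critical_point F \<longleftrightarrow>
     (\<exists>S. finite S \<and>
        (\<forall>z0 w \<gamma>. z0 \<notin> S \<and> solution_germ F w z0 \<and>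
            path \<gamma> \<and> pathstart \<gamma> = z0 \<and> path_image \<gamma> \<inter> S = {}
          \<longrightarrow> (\<exists>f. meromorphic_continuation w \<gamma> f)))"


section \<open>Rational parametrizations\<close>

text \<open>
  The last conjunct says that \<open>t\<close> is a rational function \<open>P/Q\<close> of \<open>z,x,y\<close> on the curve,
  i.e. \<open>\<complex>(z)(r1,r2) = \<complex>(z)(t)\<close>.
\<close>

definition invertible_parametrization ::
    "complex poly fract poly poly \<Rightarrow> complex poly poly fract \<Rightarrow> complex poly poly fract \<Rightarrow> bool" where
  "invertible_parametrization F r1 r2 \<longleftrightarrow>
     poly2 (map_poly2 embed_z F) r1 r2 = 0 \<and>
     (\<exists>P Q. poly2 (map_poly2 embed_z Q) r1 r2 \<noteq> 0 \<and>
        var_t = poly2 (map_poly2 embed_z P) r1 r2 / poly2 (map_poly2 embed_z Q) r1 r2)"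

end

theory Submission
  imports Defs
begin

text \<open>
  On the parametrized curve the equation reads \<open>dt/dz = P(t,z)/Q(t,z)\<close>.  Suppose that \<open>Q\<close>
  depends on \<open>t\<close>, choose a generic \<open>z0\<close> and a zero \<open>t0\<close> of \<open>Q\<close> over it, and solve the reciprocal
  equation \<open>dz/dt = Q/P\<close> near \<open>t0\<close>.  The solution \<open>z = \<phi>(t)\<close> is analytic with
  \<open>\<phi>'(t0) = 0\<close>.  Near a regular point of \<open>\<phi>\<close> the function \<open>w = r1(t, \<phi>(t))\<close> of \<open>z = \<phi>(t)\<close>
  solves \<open>F(z,w,w') = 0\<close>; as critical points are fixed, it continues meromorphically to \<open>z0\<close>
  along the image under \<open>\<phi>\<close> of a segment ending in \<open>t0\<close>.  Then \<open>w\<close>, \<open>w'\<close> and, by inversion of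
  the parametrization, \<open>t\<close> are single-valued functions of \<open>z\<close> near \<open>z0\<close>, so \<open>\<phi>\<close> is injective near
  \<open>t0\<close>, which contradicts \<open>\<phi>'(t0) = 0\<close>.  If \<open>Q\<close> is free of \<open>t\<close> but \<open>P\<close> has degree at least 3
  in \<open>t\<close>, the same argument applies at \<open>t = \<infinity>\<close>.
\<close>

section \<open>Evaluating and differentiating fractions\<close>

text \<open>The hypothesis on critical points speaks of solutions \<open>w\<close>, while the
  singular behaviour is visible in \<open>t\<close>. Every step therefore passes through the
  correspondence between \<open>t\<close> and \<open>(w, w')\<close>, which is defined only off a
  proper algebraic subset of the \<open>(t,z)\<close>-plane. This obstacle shapes the proof: all bad
  loci are collected in one nonzero polynomial \<open>N\<close>, and the solution curve must meet
  \<open>N = 0\<close> only in isolated points, even if it starts on it. The freedom to choose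
  \<open>z0\<close> outside a finite set secures this, because over a generic \<open>z0\<close> no
  branch of \<open>N = 0\<close> is tangent to the line \<open>z = z0\<close>, whereas the solution
  curve is. Passing to \<open>dz/dt\<close> replaces Puiseux series: a Bezout identity for the
  coprime \<open>P\<close> and \<open>Q\<close> makes \<open>P\<close> nonzero at a zero of
  \<open>Q\<close> over a generic \<open>z0\<close>, so the reciprocal equation is regular there and
  ordinary Picard iteration applies. The bound 2 on the degree reflects the double pole of
  \<open>dt = - ds / s^2\<close> under \<open>t = 1/s\<close>.\<close>

locale fract_evaluation =
  fixes ev :: "'a::{ring_gcd,idom_divide,semiring_gcd_mult_normalize} \<Rightarrow> 'b::field"
  assumes ev_add: "ev (a + b) = ev a + ev b"
    and ev_mult: "ev (a * b) = ev a * ev b"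
    and ev_0: "ev 0 = 0"
    and ev_1: "ev 1 = 1"
begin

definition regular :: "'a fract \<Rightarrow> bool" where
  "regular q \<longleftrightarrow> ev (snd (quot_of_fract q)) \<noteq> 0"

definition val :: "'a fract \<Rightarrow> 'b" where
  "val q = ev (fst (quot_of_fract q)) / ev (snd (quot_of_fract q))"

lemma ev_uminus: "ev (- a) = - ev a"
  using ev_add[of a "-a"] ev_0 by (simp add: eq_neg_iff_add_eq_0 add.commute)

lemma ev_diff: "ev (a - b) = ev a - ev b"
  using ev_add[of a "- b"] by (simp add: ev_uminus)

text \<open>The reduced denominator divides every other denominator of the same fraction, by
  coprimality. One representation with nonvanishing denominator thus settles regularity and value,
  and the arithmetic rules below never have to compute a reduced form.\<close>

lemma Fract_regular_val:
  assumes "ev b \<noteq> 0"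
  shows "regular (Fract a b)" "val (Fract a b) = ev a / ev b"
proof -
  define c d where "c = fst (quot_of_fract (Fract a b))" and "d = snd (quot_of_fract (Fract a b))"
  have b: "b \<noteq> 0"
    using assms ev_0 by auto
  have d: "d \<noteq> 0"
    by (simp add: d_def)
  have "Fract a b = Fract c d"
    unfolding c_def d_def by (metis Fract_quot_of_fract)
  hence eq: "a * d = c * b"
    using b d by (simp add: eq_fract)
  have "coprime c d"
    unfolding c_def d_def by (rule coprime_quot_of_fract)
  moreover have "d dvd c * b"
    using eq by (metis dvd_triv_right)
  ultimately have "d dvd b"
    by (simp add: coprime_commute coprime_dvd_mult_right_iff)
  then obtain k where "b = d * k"
    by (elim dvdE)
  hence evd: "ev d \<noteq> 0"
    using assms by (auto simp: ev_mult)
  thus "regular (Fract a b)"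
    by (simp add: regular_def d_def)
  have "ev a * ev d = ev c * ev b"
    using eq by (metis ev_mult)
  thus "val (Fract a b) = ev a / ev b"
    using assms evd unfolding val_def c_def[symmetric] d_def[symmetric]
    by (simp add: field_simps)
qed

lemma regularE:
  assumes "regular q"
  obtains a b where "q = Fract a b" "ev b \<noteq> 0" "b \<noteq> 0" "val q = ev a / ev b"
  using that[of "fst (quot_of_fract q)" "snd (quot_of_fract q)"] assms
  by (simp add: regular_def val_def)

lemma val_0: "regular 0" "val 0 = 0"
  using Fract_regular_val[of 1 0] by (simp_all add: ev_1 ev_0 fract_collapse)

lemma val_1: "regular 1" "val 1 = 1"
  using Fract_regular_val[of 1 1] by (simp_all add: ev_1 fract_collapse)

lemma val_add:
  assumes "regular p" "regular q"
  shows "regular (p + q)" "val (p + q) = val p + val q"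
proof -
  obtain a b where p: "p = Fract a b" "ev b \<noteq> 0" "b \<noteq> 0" "val p = ev a / ev b"
    using assms(1) by (rule regularE)
  obtain c d where q: "q = Fract c d" "ev d \<noteq> 0" "d \<noteq> 0" "val q = ev c / ev d"
    using assms(2) by (rule regularE)
  have pq: "p + q = Fract (a * d + c * b) (b * d)"
    using p q by simp
  have ev: "ev (b * d) \<noteq> 0"
    using p q by (simp add: ev_mult)
  show "regular (p + q)" "val (p + q) = val p + val q"
    unfolding p(4) q(4) unfolding pq Fract_regular_val(2)[OF ev]
    using Fract_regular_val(1)[OF ev] p(2) q(2) by (simp_all add: ev_mult ev_add field_simps)
qed

lemma val_mult:
  assumes "regular p" "regular q"
  shows "regular (p * q)" "val (p * q) = val p * val q"
proof -
  obtain a b where p: "p = Fract a b" "ev b \<noteq> 0" "b \<noteq> 0" "val p = ev a / ev b"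
    using assms(1) by (rule regularE)
  obtain c d where q: "q = Fract c d" "ev d \<noteq> 0" "d \<noteq> 0" "val q = ev c / ev d"
    using assms(2) by (rule regularE)
  show "regular (p * q)" "val (p * q) = val p * val q"
    using Fract_regular_val[of "b * d" "a * c"] p q
    by (auto simp: ev_mult)
qed

lemma val_uminus:
  assumes "regular p"
  shows "regular (- p)" "val (- p) = - val p"
proof -
  obtain a b where p: "p = Fract a b" "ev b \<noteq> 0" "b \<noteq> 0" "val p = ev a / ev b"
    using assms by (rule regularE)
  show "regular (- p)" "val (- p) = - val p"
    using Fract_regular_val[of b "- a"] p by (auto simp: ev_uminus)
qed

lemma val_diff:
  assumes "regular p" "regular q"
  shows "regular (p - q)" "val (p - q) = val p - val q"
  using val_add[OF assms(1) val_uminus(1)[OF assms(2)]] val_uminus(2)[OF assms(2)] by auto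

lemma val_power:
  assumes "regular p"
  shows "regular (p ^ n)" "val (p ^ n) = val p ^ n"
  by (induction n) (auto simp: val_1 val_mult assms)

lemma val_inverse:
  assumes "regular p" "val p \<noteq> 0"
  shows "regular (inverse p)" "val (inverse p) = inverse (val p)"
proof -
  obtain a b where p: "p = Fract a b" "ev b \<noteq> 0" "b \<noteq> 0" "val p = ev a / ev b"
    using assms(1) by (rule regularE)
  show "regular (inverse p)" "val (inverse p) = inverse (val p)"
    using Fract_regular_val[of a b] p assms(2) by auto
qed

lemma val_divide:
  assumes "regular p" "regular q" "val q \<noteq> 0"
  shows "regular (p / q)" "val (p / q) = val p / val q"
  using val_mult[OF assms(1) val_inverse(1)[OF assms(2,3)]] val_inverse(2)[OF assms(2,3)]
  by (auto simp: divide_inverse)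

end

locale ring_derivation =
  fixes D :: "'a::{ring_gcd,idom_divide,semiring_gcd_mult_normalize} \<Rightarrow> 'a"
  assumes D_add: "D (a + b) = D a + D b"
    and D_mult: "D (a * b) = D a * b + a * D b"
begin

text \<open>The quotient rule does not depend on the representation: applying \<open>D\<close> to
  the cross-multiplied equality of two representations gives a second relation, and the claim is a
  polynomial consequence of both.\<close>

lemma fract_derivation_Fract:
  assumes "b \<noteq> 0"
  shows "fract_derivation D (Fract a b) = Fract (D a * b - a * D b) (b * b)"
proof -
  define c d where "c = fst (quot_of_fract (Fract a b))" and "d = snd (quot_of_fract (Fract a b))"
  have d: "d \<noteq> 0"
    by (simp add: d_def)
  have "Fract a b = Fract c d"
    unfolding c_def d_def by (metis Fract_quot_of_fract)
  hence eq: "a * d = c * b"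
    using assms d by (simp add: eq_fract)
  have Deq: "D a * d + a * D d = D c * b + c * D b"
    using arg_cong[OF eq, of D] by (simp add: D_mult)
  have "(D c * d - c * D d) * (b * b) = (D a * b - a * D b) * (d * d)"
    using eq Deq by algebra
  thus ?thesis
    using assms d
    by (simp add: fract_derivation_def Let_def case_prod_beta c_def[symmetric] d_def[symmetric] eq_fract)
qed

lemma fract_derivation_add:
  "fract_derivation D (p + q) = fract_derivation D p + fract_derivation D q"
proof -
  obtain a b where p: "p = Fract a b" "b \<noteq> 0"
    by (cases p) auto
  obtain c d where q: "q = Fract c d" "d \<noteq> 0"
    by (cases q) auto
  show ?thesis
    unfolding p(1) q(1) using p(2) q(2)
    by (simp add: fract_derivation_Fract D_add D_mult eq_fract) algebra
qed

lemma fract_derivation_mult: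
  "fract_derivation D (p * q) = fract_derivation D p * q + p * fract_derivation D q"
proof -
  obtain a b where p: "p = Fract a b" "b \<noteq> 0"
    by (cases p) auto
  obtain c d where q: "q = Fract c d" "d \<noteq> 0"
    by (cases q) auto
  show ?thesis
    unfolding p(1) q(1) using p(2) q(2)
    by (simp add: fract_derivation_Fract D_add D_mult eq_fract) algebra
qed

end

section \<open>Evaluation and differentiation in one and in two variables\<close>

lemma poly2_0 [simp]: "poly2 0 x y = 0"
  by (simp add: poly2_def)

lemma poly2_1 [simp]: "poly2 1 x y = 1"
  by (simp add: poly2_def)

lemma poly2_add: "poly2 (P + Q) x y = poly2 P x y + poly2 Q x y"
  by (simp add: poly2_def)

lemma poly2_mult:
  fixes P Q :: "'a::comm_ring_1 poly poly"
  shows "poly2 (P * Q) x y = poly2 P x y * poly2 Q x y"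
  by (simp add: poly2_def)

lemma poly2_pCons [simp]: "poly2 (pCons a P) x y = poly a x + y * poly2 P x y"
  by (simp add: poly2_def)

lemma poly2_eq_poly_map_poly:
  "poly2 P x y = poly (map_poly (\<lambda>p. poly p x) P) y"
  by (induction P) (auto simp: map_poly_pCons)

text \<open>The chain rule along the curve \<open>(f s, g s)\<close>: differentiating the
  coefficients is the partial derivative in the inner variable, \<open>pderiv\<close> the one in the
  outer variable.\<close>

lemma poly2_has_field_derivative:
  fixes P :: "complex poly poly"
  assumes "(f has_field_derivative f') (at s)" "(g has_field_derivative g') (at s)"
  shows "((\<lambda>s. poly2 P (f s) (g s)) has_field_derivative
           poly2 (map_poly pderiv P) (f s) (g s) * f' + poly2 (pderiv P) (f s) (g s) * g') (at s)"
proof (induction P)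
  case 0
  show ?case by simp
next
  case (pCons a P)
  have "((\<lambda>s. poly a (f s)) has_field_derivative poly (pderiv a) (f s) * f') (at s)"
    by (rule DERIV_chain2[OF poly_DERIV assms(1)])
  from DERIV_add[OF this DERIV_mult[OF assms(2) pCons.IH]] show ?case
    by (simp add: map_poly_pCons pderiv_pCons poly2_add algebra_simps)
qed

interpretation ratfun: fract_evaluation "\<lambda>p. poly p z"
  rewrites "fract_evaluation.regular (\<lambda>p. poly p z) q = ratfun_regular q z"
    and "fract_evaluation.val (\<lambda>p. poly p z) q = ratfun_eval q z"
  for z :: complex
proof -
  show "fract_evaluation (\<lambda>p. poly p z)"
    by unfold_locales auto
  then interpret fract_evaluation "\<lambda>p. poly p z" .
  show "regular q = ratfun_regular q z" "val q = ratfun_eval q z"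
    by (simp_all add: regular_def val_def ratfun_regular_def ratfun_eval_def)
qed

text \<open>Mind the order of arguments: \<open>poly2\<close> takes the inner variable
  \<open>z\<close> first, \<open>ratfun2_eval\<close> and \<open>ratfun2_regular\<close> take
  \<open>t\<close> first.\<close>

interpretation ratfun2: fract_evaluation "\<lambda>P. poly2 P z t"
  rewrites "fract_evaluation.regular (\<lambda>P. poly2 P z t) q = ratfun2_regular q t z"
    and "fract_evaluation.val (\<lambda>P. poly2 P z t) q = ratfun2_eval q t z"
  for z t :: complex
proof -
  show "fract_evaluation (\<lambda>P. poly2 P z t)"
    by unfold_locales (auto simp: poly2_add poly2_mult)
  then interpret fract_evaluation "\<lambda>P. poly2 P z t" .
  show "regular q = ratfun2_regular q t z" "val q = ratfun2_eval q t z"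
    by (simp_all add: regular_def val_def ratfun2_regular_def ratfun2_eval_def)
qed

lemma map_poly_pderiv_add:
  fixes P Q :: "complex poly poly"
  shows "map_poly pderiv (P + Q) = map_poly pderiv P + map_poly pderiv Q"
  by (intro poly_eqI) (simp add: coeff_map_poly pderiv_add)

lemma map_poly_pderiv_smult:
  fixes a :: "complex poly" and P :: "complex poly poly"
  shows "map_poly pderiv (smult a P) = smult (pderiv a) P + smult a (map_poly pderiv P)"
  by (intro poly_eqI) (simp add: coeff_map_poly pderiv_mult mult.commute)

lemma map_poly_pderiv_mult:
  fixes P Q :: "complex poly poly"
  shows "map_poly pderiv (P * Q) = map_poly pderiv P * Q + P * map_poly pderiv Q"
  by (induction P) (simp_all add: map_poly_pCons map_poly_pderiv_add map_poly_pderiv_smult algebra_simps)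

interpretation pderiv: ring_derivation "pderiv :: complex poly \<Rightarrow> complex poly"
  by unfold_locales (auto simp: pderiv_add pderiv_mult)

interpretation deriv_t: ring_derivation "pderiv :: complex poly poly \<Rightarrow> complex poly poly"
  rewrites "fract_derivation (pderiv :: complex poly poly \<Rightarrow> complex poly poly) = deriv_t"
  by unfold_locales (auto simp: pderiv_add pderiv_mult deriv_t_def)

interpretation deriv_z: ring_derivation "map_poly pderiv :: complex poly poly \<Rightarrow> complex poly poly"
  rewrites "fract_derivation (map_poly pderiv :: complex poly poly \<Rightarrow> complex poly poly) = deriv_z"
  by unfold_locales (auto simp: map_poly_pderiv_add map_poly_pderiv_mult deriv_z_def)

lemma ratfun_eval_has_field_derivative:
  assumes "ratfun_regular q z"
  shows "ratfun_regular (fract_derivation pderiv q) z"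
    and "(ratfun_eval q has_field_derivative ratfun_eval (fract_derivation pderiv q) z) (at z)"
proof -
  define a b where "a = fst (quot_of_fract q)" and "b = snd (quot_of_fract q)"
  have b: "poly b z \<noteq> 0"
    using assms by (simp add: ratfun_regular_def b_def)
  hence b0: "b \<noteq> 0"
    by auto
  have q: "q = Fract a b"
    by (simp add: a_def b_def)
  have D: "fract_derivation pderiv q = Fract (pderiv a * b - a * pderiv b) (b * b)"
    using pderiv.fract_derivation_Fract[OF b0] q by simp
  show "ratfun_regular (fract_derivation pderiv q) z"
    unfolding D by (rule ratfun.Fract_regular_val) (use b in auto)
  have "ratfun_eval (fract_derivation pderiv q) z
      = poly (pderiv a * b - a * pderiv b) z / poly (b * b) z"
    unfolding D by (rule ratfun.Fract_regular_val) (use b in auto)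
  moreover have "((\<lambda>z. poly a z / poly b z) has_field_derivative
      poly (pderiv a * b - a * pderiv b) z / poly (b * b) z) (at z)"
    by (rule derivative_eq_intros refl b)+ (simp add: field_simps)
  ultimately show "(ratfun_eval q has_field_derivative ratfun_eval (fract_derivation pderiv q) z) (at z)"
    by (simp add: ratfun_eval_def[abs_def] a_def b_def)
qed

lemma ratfun2_eval_has_field_derivative:
  assumes "ratfun2_regular q (T s) (\<phi> s)"
    and "(T has_field_derivative T') (at s)" "(\<phi> has_field_derivative \<phi>') (at s)"
  shows "((\<lambda>s. ratfun2_eval q (T s) (\<phi> s)) has_field_derivative
      ratfun2_eval (deriv_t q) (T s) (\<phi> s) * T' + ratfun2_eval (deriv_z q) (T s) (\<phi> s) * \<phi>') (at s)"
proof -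
  define a b where "a = fst (quot_of_fract q)" and "b = snd (quot_of_fract q)"
  have b: "poly2 b (\<phi> s) (T s) \<noteq> 0"
    using assms by (simp add: ratfun2_regular_def b_def)
  hence b0: "b \<noteq> 0"
    by auto
  have q: "q = Fract a b"
    by (simp add: a_def b_def)
  have t: "ratfun2_eval (deriv_t q) (T s) (\<phi> s)
      = poly2 (pderiv a * b - a * pderiv b) (\<phi> s) (T s) / poly2 (b * b) (\<phi> s) (T s)"
    unfolding q deriv_t.fract_derivation_Fract[OF b0] using b
    by (subst ratfun2.Fract_regular_val) (auto simp: poly2_mult)
  have z: "ratfun2_eval (deriv_z q) (T s) (\<phi> s)
      = poly2 (map_poly pderiv a * b - a * map_poly pderiv b) (\<phi> s) (T s) / poly2 (b * b) (\<phi> s) (T s)"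
    unfolding q deriv_z.fract_derivation_Fract[OF b0] using b
    by (subst ratfun2.Fract_regular_val) (auto simp: poly2_mult)
  have "((\<lambda>s. poly2 a (\<phi> s) (T s) / poly2 b (\<phi> s) (T s)) has_field_derivative
      ratfun2_eval (deriv_t q) (T s) (\<phi> s) * T' + ratfun2_eval (deriv_z q) (T s) (\<phi> s) * \<phi>') (at s)"
    unfolding t z
    by (rule derivative_eq_intros poly2_has_field_derivative assms refl b)+
      (use b in \<open>simp add: field_simps poly2_mult ratfun2.ev_diff\<close>)
  thus ?thesis
    by (simp add: ratfun2_eval_def[abs_def] a_def b_def)
qed

lemma deriv_regular:
  assumes "ratfun2_regular q t z"
  shows "ratfun2_regular (deriv_t q) t z" "ratfun2_regular (deriv_z q) t z"
proof -
  define a b where "a = fst (quot_of_fract q)" and "b = snd (quot_of_fract q)"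
  have b: "poly2 b z t \<noteq> 0"
    using assms by (simp add: ratfun2_regular_def b_def)
  hence b0: "b \<noteq> 0"
    by auto
  have q: "q = Fract a b"
    by (simp add: a_def b_def)
  show "ratfun2_regular (deriv_t q) t z" "ratfun2_regular (deriv_z q) t z"
    unfolding q deriv_t.fract_derivation_Fract[OF b0] deriv_z.fract_derivation_Fract[OF b0]
    by (rule ratfun2.Fract_regular_val; use b in \<open>simp add: poly2_mult\<close>)+
qed

section \<open>The embedding of the field of rational functions of \<open>z\<close> into that of
  \<open>t\<close> and \<open>z\<close>\<close>

lemma embed_z_Fract:
  assumes "b \<noteq> 0"
  shows "embed_z (Fract a b) = Fract [:a:] [:b:]"
proof -
  define c d where "c = fst (quot_of_fract (Fract a b))" and "d = snd (quot_of_fract (Fract a b))"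
  have d: "d \<noteq> 0"
    by (simp add: d_def)
  have "Fract a b = Fract c d"
    unfolding c_def d_def by (metis Fract_quot_of_fract)
  hence "a * d = c * b"
    using assms d by (simp add: eq_fract)
  thus ?thesis
    using assms d by (simp add: embed_z_def c_def[symmetric] d_def[symmetric] eq_fract mult.commute)
qed

lemma embed_z_0 [simp]: "embed_z 0 = 0"
  using embed_z_Fract[of 1 0] by (simp add: fract_collapse)

lemma embed_z_add: "embed_z (p + q) = embed_z p + embed_z q"
proof -
  obtain a b where p: "p = Fract a b" "b \<noteq> 0"
    by (cases p) auto
  obtain c d where q: "q = Fract c d" "d \<noteq> 0"
    by (cases q) auto
  show ?thesis
    unfolding p(1) q(1) using p(2) q(2) by (simp add: embed_z_Fract mult.commute add.commute)
qed

lemma embed_z_mult: "embed_z (p * q) = embed_z p * embed_z q"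
proof -
  obtain a b where p: "p = Fract a b" "b \<noteq> 0"
    by (cases p) auto
  obtain c d where q: "q = Fract c d" "d \<noteq> 0"
    by (cases q) auto
  show ?thesis
    unfolding p(1) q(1) using p(2) q(2) by (simp add: embed_z_Fract mult.commute add.commute)
qed

lemma embed_z_eq_0_iff [simp]: "embed_z q = 0 \<longleftrightarrow> q = 0"
proof -
  obtain a b where q: "q = Fract a b" "b \<noteq> 0"
    by (cases q) auto
  show ?thesis
    unfolding q(1) using q(2) by (simp add: embed_z_Fract Zero_fract_def eq_fract)
qed

lemma embed_z_regular_eval:
  assumes "ratfun_regular q z"
  shows "ratfun2_regular (embed_z q) t z" "ratfun2_eval (embed_z q) t z = ratfun_eval q z"
  using assms unfolding embed_z_def
  by (subst ratfun2.Fract_regular_val; simp add: ratfun_regular_def ratfun_eval_def)+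

lemma deriv_t_embed_z [simp]: "deriv_t (embed_z q) = 0"
  unfolding embed_z_def
  by (subst deriv_t.fract_derivation_Fract) (simp_all add: fract_collapse pderiv_pCons)

lemma deriv_t_0 [simp]: "deriv_t 0 = 0"
  using deriv_t_embed_z[of 0] by simp

lemma deriv_t_var_t: "deriv_t var_t = 1"
  by (simp add: var_t_def to_fract_def deriv_t.fract_derivation_Fract pderiv_pCons
      fract_collapse flip: one_pCons)

lemma var_t_regular_eval: "ratfun2_regular var_t t z" "ratfun2_eval var_t t z = t"
  unfolding var_t_def to_fract_def by (subst ratfun2.Fract_regular_val; simp)+

lemma map_poly2_pCons:
  assumes "h 0 = 0"
  shows "map_poly2 h (pCons a F) = pCons (map_poly h a) (map_poly2 h F)"
  using assms by (simp add: map_poly2_def map_poly_pCons)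

lemma map_poly2_0 [simp]: "map_poly2 h 0 = 0"
  by (simp add: map_poly2_def)

lemma poly_embed_z_regular_eval:
  assumes "\<And>j. ratfun_regular (coeff a j) z" "ratfun2_regular x t z"
  shows "ratfun2_regular (poly (map_poly embed_z a) x) t z \<and>
    ratfun2_eval (poly (map_poly embed_z a) x) t z
      = poly (map_poly (\<lambda>q. ratfun_eval q z) a) (ratfun2_eval x t z)"
  using assms(1)
proof (induction a)
  case 0
  show ?case by (simp add: ratfun2.val_0)
next
  case (pCons c a)
  have c: "ratfun_regular c z"
    using pCons.prems[of 0] by simp
  have a: "ratfun_regular (coeff a j) z" for j
    using pCons.prems[of "Suc j"] by simp
  note IH = pCons.IH[OF a]
  show ?case
    using IH c assms(2)
    by (simp add: map_poly_pCons ratfun.val_0 ratfun2.val_add ratfun2.val_mult embed_z_regular_eval)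
qed

text \<open>This links the algebraic relation between \<open>r1\<close> and \<open>r2\<close> with
  pointwise relations for \<open>ode_at\<close>. Regular coefficients are demanded because
  \<open>ode_at\<close> inserts the dummy value 0 at a pole.\<close>

lemma poly2_embed_z_regular_eval:
  assumes "\<And>i j. ratfun_regular (coeff (coeff F i) j) z"
    and "ratfun2_regular x t z" "ratfun2_regular y t z"
  shows "ratfun2_regular (poly2 (map_poly2 embed_z F) x y) t z"
    and "ratfun2_eval (poly2 (map_poly2 embed_z F) x y) t z
      = poly2 (ode_at F z) (ratfun2_eval x t z) (ratfun2_eval y t z)"
proof -
  have "ratfun2_regular (poly2 (map_poly2 embed_z F) x y) t z \<and>
    ratfun2_eval (poly2 (map_poly2 embed_z F) x y) t z
      = poly2 (ode_at F z) (ratfun2_eval x t z) (ratfun2_eval y t z)"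
    using assms(1)
  proof (induction F)
    case 0
    show ?case by (simp add: ratfun2.val_0 ode_at_def)
  next
    case (pCons c a)
    have c: "ratfun_regular (coeff c j) z" for j
      using pCons.prems[of 0 j] by simp
    have a: "ratfun_regular (coeff (coeff a i) j) z" for i j
      using pCons.prems[of "Suc i" j] by simp
    show ?case
      using pCons.IH[OF a] poly_embed_z_regular_eval[OF c assms(2)] assms(2,3)
      by (simp add: ode_at_def map_poly2_pCons ratfun.val_0 ratfun2.val_add ratfun2.val_mult)
  qed
  thus "ratfun2_regular (poly2 (map_poly2 embed_z F) x y) t z"
    "ratfun2_eval (poly2 (map_poly2 embed_z F) x y) t z
      = poly2 (ode_at F z) (ratfun2_eval x t z) (ratfun2_eval y t z)"
    by auto
qed

section \<open>Generic points of the plane\<close>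

text \<open>Validity off an algebraic curve. An explicit polynomial \<open>N\<close> as witness
  makes conjunctions a matter of multiplying witnesses, and reduces genericity along an analytic
  curve to nonvanishing of one holomorphic function.\<close>

definition generic :: "(complex \<Rightarrow> complex \<Rightarrow> bool) \<Rightarrow> bool" where
  "generic P \<longleftrightarrow> (\<exists>N. N \<noteq> 0 \<and> (\<forall>t z. poly2 N z t \<noteq> 0 \<longrightarrow> P t z))"

lemma genericI: "N \<noteq> 0 \<Longrightarrow> (\<And>t z. poly2 N z t \<noteq> 0 \<Longrightarrow> P t z) \<Longrightarrow> generic P"
  unfolding generic_def by blast

lemma generic_conj:
  assumes "generic P" "generic Q"
  shows "generic (\<lambda>t z. P t z \<and> Q t z)"
proof -
  obtain M where M: "M \<noteq> 0" "\<And>t z. poly2 M z t \<noteq> 0 \<Longrightarrow> P t z"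
    using assms(1) unfolding generic_def by blast
  obtain N where N: "N \<noteq> 0" "\<And>t z. poly2 N z t \<noteq> 0 \<Longrightarrow> Q t z"
    using assms(2) unfolding generic_def by blast
  show ?thesis
    by (rule genericI[of "M * N"]) (use M N in \<open>auto simp: poly2_mult\<close>)
qed

lemma generic_regular: "generic (ratfun2_regular q)"
  by (rule genericI[of "snd (quot_of_fract q)"]) (auto simp: ratfun2_regular_def)

lemma generic_nonzero:
  assumes "q \<noteq> 0"
  shows "generic (\<lambda>t z. ratfun2_eval q t z \<noteq> 0)"
proof (rule genericI[of "fst (quot_of_fract q) * snd (quot_of_fract q)"])
  have "fst (quot_of_fract q) \<noteq> 0"
    using assms by (metis Fract_quot_of_fract fract_collapse(1))
  thus "fst (quot_of_fract q) * snd (quot_of_fract q) \<noteq> 0"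
    by simp
qed (auto simp: ratfun2_eval_def poly2_mult)

lemma generic_ratfun_regular: "generic (\<lambda>t z. ratfun_regular q z)"
  by (rule genericI[of "[:snd (quot_of_fract q):]"]) (auto simp: ratfun_regular_def)

lemma generic_True: "generic (\<lambda>t z. True)"
  by (rule genericI[of 1]) auto

text \<open>The quantifier over all \<open>j\<close> is in effect finite, since the coefficients
  beyond the degree are 0 and hence regular everywhere; induction on the polynomial exploits
  this.\<close>

lemma generic_coeff_regular: "generic (\<lambda>t z. \<forall>j. ratfun_regular (coeff a j) z)"
proof (induction a)
  case 0
  show ?case using generic_True by (simp add: ratfun.val_0)
next
  case (pCons c a)
  have "(\<forall>j. ratfun_regular (coeff (pCons c a) j) z)
      \<longleftrightarrow> ratfun_regular c z \<and> (\<forall>j. ratfun_regular (coeff a j) z)" for z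
    by (auto simp: coeff_pCons split: nat.splits)
  with generic_conj[OF generic_ratfun_regular pCons.IH] show ?case
    by simp
qed

lemma generic_coeff_coeff_regular:
  "generic (\<lambda>t z. \<forall>i j. ratfun_regular (coeff (coeff F i) j) z)"
proof (induction F)
  case 0
  show ?case using generic_True by (simp add: ratfun.val_0)
next
  case (pCons c a)
  have "(\<forall>i j. ratfun_regular (coeff (coeff (pCons c a) i) j) z)
      \<longleftrightarrow> (\<forall>j. ratfun_regular (coeff c j) z) \<and> (\<forall>i j. ratfun_regular (coeff (coeff a i) j) z)" for z
    by (auto simp: coeff_pCons split: nat.splits)
  with generic_conj[OF generic_coeff_regular pCons.IH] show ?case
    by simp
qed

section \<open>The parametrization depends on its parameter\<close>

lemma poly_embed_z: "poly (map_poly embed_z a) (embed_z \<rho>) = embed_z (poly a \<rho>)"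
  by (induction a) (simp_all add: map_poly_pCons embed_z_add embed_z_mult)

lemma poly2_embed_z:
  "poly2 (map_poly2 embed_z F) (embed_z \<rho>) y = poly (map_poly embed_z (map_poly (\<lambda>p. poly p \<rho>) F)) y"
  by (induction F) (simp_all add: map_poly_pCons map_poly2_pCons poly_embed_z)

lemma map_poly_embed_z_add:
  "map_poly embed_z (p + q) = map_poly embed_z p + map_poly embed_z q"
  by (intro poly_eqI) (simp add: coeff_map_poly embed_z_add)

lemma deriv_t_poly_embed_z:
  "deriv_t (poly (map_poly embed_z f) x) = poly (map_poly embed_z (pderiv f)) x * deriv_t x"
  by (induction f)
    (simp_all add: map_poly_pCons pderiv_pCons deriv_t.fract_derivation_add
      deriv_t.fract_derivation_mult map_poly_embed_z_add algebra_simps)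

text \<open>Applying the derivation to \<open>f(x) = 0\<close> gives
  \<open>f'(x) * deriv_t x = 0\<close>, since the coefficients are constants for
  \<open>deriv_t\<close>. Either \<open>deriv_t x = 0\<close>, or \<open>x\<close> is a root of
  \<open>f'\<close>, which has smaller degree and is nonzero in characteristic 0.\<close>

lemma deriv_t_eq_0_if_algebraic:
  assumes "f \<noteq> 0" "poly (map_poly embed_z f) x = 0"
  shows "deriv_t x = 0"
  using assms
proof (induction "degree f" arbitrary: f rule: less_induct)
  case less
  show ?case
  proof (cases "degree f = 0")
    case True
    then obtain c where "f = [:c:]"
      by (rule degree_eq_zeroE)
    thus ?thesis
      using less.prems by (auto simp: map_poly_pCons)
  next
    case False
    have "poly (map_poly embed_z (pderiv f)) x * deriv_t x = 0"
      using deriv_t_poly_embed_z[of f x] less.prems by simp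
    moreover have "of_nat (degree f) \<noteq> (0 :: complex poly fract)"
      using False by (simp add: of_nat_fract Zero_fract_def eq_fract)
    hence "coeff (pderiv f) (degree f - 1) \<noteq> 0"
      using False less.prems(1) by (simp add: coeff_pderiv)
    hence "pderiv f \<noteq> 0"
      by auto
    moreover have "degree (pderiv f) < degree f"
    proof (rule le_less_trans[OF degree_le])
      show "\<forall>i>degree f - 1. coeff (pderiv f) i = 0"
        by (auto simp: coeff_pderiv coeff_eq_0)
    qed (use False in simp)
    ultimately show ?thesis
      using less.hyps by auto
  qed
qed

lemma deriv_t_poly2_eq_0:
  assumes "deriv_t x = 0" "deriv_t y = 0"
  shows "deriv_t (poly2 (map_poly2 embed_z F) x y) = 0"
  by (induction F)
    (simp_all add: map_poly2_pCons deriv_t.fract_derivation_add deriv_t.fract_derivation_mult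
      deriv_t_poly_embed_z assms)

lemma deriv_t_divide_eq_0:
  assumes "deriv_t x = 0" "deriv_t y = 0" "y \<noteq> 0"
  shows "deriv_t (x / y) = 0"
  using deriv_t.fract_derivation_mult[of "x / y" y] assms by simp

text \<open>For a reduced fraction \<open>a/b\<close> with derivative 0, \<open>a' b = a b'\<close>
  and coprimality force \<open>b\<close> to divide \<open>b'\<close>, hence \<open>b' = 0\<close> by
  degree, and then \<open>a' = 0\<close>: both parts are free of \<open>t\<close>.\<close>

lemma deriv_t_eq_0_imp_embed_z:
  assumes "deriv_t q = 0"
  obtains \<rho> where "q = embed_z \<rho>"
proof -
  define a b where "a = fst (quot_of_fract q)" and "b = snd (quot_of_fract q)"
  have b: "b \<noteq> 0"
    by (simp add: b_def)
  have q: "q = Fract a b"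
    by (simp add: a_def b_def)
  have "coprime a b"
    unfolding a_def b_def by (rule coprime_quot_of_fract)
  have eq: "pderiv a * b = a * pderiv b"
    using assms b unfolding q by (simp add: deriv_t.fract_derivation_Fract Zero_fract_def eq_fract)
  hence "b dvd a * pderiv b"
    by (metis dvd_triv_right)
  hence "b dvd pderiv b"
    using \<open>coprime a b\<close> by (simp add: coprime_commute coprime_dvd_mult_right_iff)
  hence b': "degree b = 0"
    by (metis degree_pderiv diff_less dvd_imp_degree_le not_less pderiv_eq_0_iff zero_less_one
        gr_zeroI)
  hence "pderiv b = 0"
    by (simp add: pderiv_eq_0_iff)
  hence "pderiv a = 0"
    using eq b by simp
  hence "degree a = 0"
    by (simp add: pderiv_eq_0_iff)
  then obtain a0 where a0: "a = [:a0:]"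
    by (rule degree_eq_zeroE)
  obtain b0 where b0: "b = [:b0:]"
    using b' by (rule degree_eq_zeroE)
  show ?thesis
    by (rule that[of "Fract a0 b0"]) (use q b a0 b0 in \<open>simp add: embed_z_Fract\<close>)
qed

text \<open>Otherwise \<open>r1\<close> is some \<open>\<rho>(z)\<close>. If
  \<open>F(\<rho>, y)\<close> is a nonzero polynomial in \<open>y\<close>, its root
  \<open>r2\<close> is algebraic over the rational functions of \<open>z\<close>, so
  \<open>r2\<close> and, by the inversion formula, \<open>t\<close> itself would be free of
  \<open>t\<close>. If it vanishes identically, \<open>x - \<rho>\<close> divides the irreducible
  \<open>F\<close>, which contradicts that \<open>y\<close> occurs in \<open>F\<close>.\<close>

lemma deriv_t_parametrization_nonzero:
  assumes "irreducible F" "first_order F" "invertible_parametrization F r1 r2"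
  shows "deriv_t r1 \<noteq> 0"
proof
  assume r1: "deriv_t r1 = 0"
  then obtain \<rho> where \<rho>: "r1 = embed_z \<rho>"
    by (rule deriv_t_eq_0_imp_embed_z)
  define f where "f = map_poly (\<lambda>p. poly p \<rho>) F"
  have F0: "poly (map_poly embed_z f) r2 = 0"
    using assms(3) unfolding invertible_parametrization_def \<rho> poly2_embed_z f_def by simp
  obtain P Q where PQ: "poly2 (map_poly2 embed_z Q) r1 r2 \<noteq> 0"
    "var_t = poly2 (map_poly2 embed_z P) r1 r2 / poly2 (map_poly2 embed_z Q) r1 r2"
    using assms(3) unfolding invertible_parametrization_def by blast
  have "f = 0"
  proof (rule ccontr)
    assume "f \<noteq> 0"
    hence "deriv_t r2 = 0"
      using F0 by (rule deriv_t_eq_0_if_algebraic)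
    hence "deriv_t var_t = 0"
      unfolding PQ(2) using r1 PQ(1) by (intro deriv_t_divide_eq_0 deriv_t_poly2_eq_0)
    thus False
      using deriv_t_var_t by simp
  qed
  hence "poly (coeff F i) \<rho> = 0" for i
    using coeff_map_poly[of "\<lambda>p. poly p \<rho>" F i] by (simp add: f_def)
  hence "[:[:- \<rho>, 1:]:] dvd F"
    by (simp add: const_poly_dvd_iff poly_eq_0_iff_dvd)
  then obtain G where G: "F = [:[:- \<rho>, 1:]:] * G"
    by (elim dvdE)
  have "\<not> is_unit [:[:- \<rho>, 1:]:]"
    by (simp add: is_unit_poly_iff)
  hence "is_unit G"
    using assms(1) irreducibleD G by blast
  hence "degree F = 0"
    by (auto simp: G is_unit_poly_iff)
  thus False
    using assms(2) by (simp add: first_order_def)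
qed

lemma quadratic_Fract:
  assumes "q \<noteq> 0"
  shows "Fract [:c, b, a:] [:q:]
    = embed_z (Fract a q) * var_t ^ 2 + embed_z (Fract b q) * var_t + embed_z (Fract c q)"
  using assms
  by (simp add: embed_z_Fract var_t_def to_fract_def power2_eq_square eq_fract)

section \<open>Elimination\<close>

text \<open>Over the rational functions of \<open>z\<close> the polynomials in \<open>t\<close> form
  a Euclidean ring, and \<open>c\<close> is the denominator cleared from a Bezout identity. The
  proof stays in the polynomial ring: the primitive part of an ideal element \<open>h\<close> of
  least degree divides both \<open>P\<close> and \<open>Q\<close>, so it is a unit and
  \<open>h\<close> is free of \<open>t\<close>.\<close>

lemma coprime_bezout_const:
  fixes P Q :: "complex poly poly"
  assumes "coprime P Q" "P \<noteq> 0"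
  obtains a b c where "c \<noteq> 0" "a * P + b * Q = [:c:]"
proof -
  define I where "I = {a * P + b * Q |a b. a * P + b * Q \<noteq> 0}"
  have "1 * P + 0 * Q \<in> I"
    using assms(2) unfolding I_def mem_Collect_eq
    by (intro exI[of _ 1] exI[of _ 0]) simp
  hence "\<exists>h\<in>I. \<forall>g\<in>I. degree h \<le> degree g"
    using ex_has_least_nat[of "\<lambda>h. h \<in> I" _ degree] by blast
  then obtain h where h: "h \<in> I" "\<And>g. g \<in> I \<Longrightarrow> degree h \<le> degree g"
    by blast
  obtain a b where ab: "h = a * P + b * Q" "h \<noteq> 0"
    using h(1) unfolding I_def by blast
  define p where "p = primitive_part h"
  have dvd: "p dvd g" if g: "g = u * P + v * Q" for g u v
  proof -
    \<comment> \<open>Pseudo-division costs only the factor \<open>l\<close>, free of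
      \<open>t\<close>; the remainder is again in the ideal and has to vanish by minimality of
      \<open>h\<close>.\<close>
    obtain l q where lq: "l \<noteq> 0" "smult l g = h * q + pseudo_mod g h"
      using pseudo_mod(1)[OF ab(2)] by blast
    have "pseudo_mod g h = 0"
    proof (rule ccontr)
      assume nz: "pseudo_mod g h \<noteq> 0"
      have "pseudo_mod g h = ([:l:] * u - q * a) * P + ([:l:] * v - q * b) * Q"
        using lq(2) g ab(1) by (simp add: algebra_simps smult_add_right)
      hence "pseudo_mod g h \<in> I"
        unfolding I_def using nz by auto
      with h(2) pseudo_mod(2)[OF ab(2), of g] nz show False
        by force
    qed
    hence "h dvd [:l:] * g"
      using lq by simp
    moreover have "p dvd h"
      unfolding p_def by (metis content_times_primitive_part dvd_smult dvd_refl)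
    ultimately have "p dvd [:l:] * g"
      by (rule dvd_trans[rotated])
    \<comment> \<open>Gauss's lemma in disguise: a common divisor is free of \<open>t\<close>, so it
      divides the content of the primitive \<open>p\<close>. The factor \<open>l\<close> can
      therefore be cancelled.\<close>
    moreover have "coprime p [:l:]"
    proof (rule coprimeI)
      fix d assume d: "d dvd p" "d dvd [:l:]"
      have "degree d = 0"
        using dvd_imp_degree_le[OF d(2)] lq(1) by simp
      then obtain d0 where d0: "d = [:d0:]"
        by (rule degree_eq_zeroE)
      have "d0 dvd content p"
        using d(1) unfolding d0 by (simp add: const_poly_dvd_iff_dvd_content)
      thus "is_unit d"
        using ab(2) by (simp add: p_def d0 is_unit_const_poly_iff)
    qed
    ultimately show ?thesis
      using coprime_dvd_mult_right_iff by blast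
  qed
  have "p dvd P" "p dvd Q"
    using dvd[of P 1 0] dvd[of Q 0 1] by simp_all
  hence "is_unit p"
    using assms(1) coprime_common_divisor by blast
  hence "degree p = 0"
    by (auto simp: is_unit_poly_iff)
  hence "degree h = 0"
    by (simp add: p_def)
  then obtain c where "h = [:c:]"
    by (rule degree_eq_zeroE)
  thus ?thesis
    using that[of c a b] ab by auto
qed

section \<open>Local existence of analytic solutions\<close>

text \<open>Picard iteration in a complex domain, with a bound \<open>L\<close> on the derivative in
  \<open>z\<close> in place of a Lipschitz condition. Holomorphy of \<open>f\<close> is required
  only along holomorphic graphs \<open>z = \<psi> s\<close>, which avoids holomorphic functions of
  two variables.\<close>

lemma picard_holomorphic:
  fixes f fz :: "complex \<Rightarrow> complex \<Rightarrow> complex"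
  assumes r: "0 < r"
    and M: "\<And>s z. s \<in> ball s0 r \<Longrightarrow> z \<in> cball z0 r \<Longrightarrow> norm (f s z) \<le> M"
    and der: "\<And>s z. s \<in> ball s0 r \<Longrightarrow> z \<in> cball z0 r \<Longrightarrow> (f s has_field_derivative fz s z) (at z)"
    and L: "\<And>s z. s \<in> ball s0 r \<Longrightarrow> z \<in> cball z0 r \<Longrightarrow> norm (fz s z) \<le> L"
    and hol: "\<And>\<psi> \<rho>. \<rho> \<le> r \<Longrightarrow> \<psi> holomorphic_on ball s0 \<rho> \<Longrightarrow> \<psi> ` ball s0 \<rho> \<subseteq> cball z0 r \<Longrightarrow>
        (\<lambda>s. f s (\<psi> s)) holomorphic_on ball s0 \<rho>"
  obtains \<rho> \<phi> where "0 < \<rho>" "\<rho> \<le> r" "\<phi> s0 = z0"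
    "\<And>s. s \<in> ball s0 \<rho> \<Longrightarrow> \<phi> s \<in> cball z0 r"
    "\<And>s. s \<in> ball s0 \<rho> \<Longrightarrow> (\<phi> has_field_derivative f s (\<phi> s)) (at s)"
proof -
  have M0: "0 \<le> M" and L0: "0 \<le> L"
    using order_trans[OF norm_ge_zero M[of s0 z0]] order_trans[OF norm_ge_zero L[of s0 z0]] r
    by simp_all
  \<comment> \<open>The second bound keeps all iterates in \<open>cball z0 r\<close>, the third
    makes the iteration contract by 1/2; the summands 1 guard against \<open>M = 0\<close> and
    \<open>L = 0\<close>.\<close>
  define \<rho> where "\<rho> = min r (min (r / (M + 1)) (1 / (2 * (L + 1))))"
  have \<rho>: "0 < \<rho>" "\<rho> \<le> r" "M * \<rho> \<le> r" "L * \<rho> \<le> 1 / 2"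
  proof -
    show "0 < \<rho>" "\<rho> \<le> r"
      using r M0 L0 by (auto simp: \<rho>_def)
    have "M * \<rho> \<le> M * (r / (M + 1))"
      using M0 by (intro mult_left_mono) (auto simp: \<rho>_def)
    also have "\<dots> \<le> r"
      using r M0 by (simp add: field_simps)
    finally show "M * \<rho> \<le> r" .
    have "L * \<rho> \<le> L * (1 / (2 * (L + 1)))"
      using L0 by (intro mult_left_mono) (auto simp: \<rho>_def)
    also have "\<dots> \<le> 1 / 2"
      using L0 by (simp add: field_simps)
    finally show "L * \<rho> \<le> 1 / 2" .
  qed
  define B where "B = ball s0 \<rho>"
  have B: "open B" "convex B" "s0 \<in> B" "B \<subseteq> ball s0 r"
    using \<rho> by (auto simp: B_def)
  have dist_B: "norm (s - s0) \<le> \<rho>" if "s \<in> B" for s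
    using that by (auto simp: B_def dist_norm norm_minus_commute)
  define good where "good = (\<lambda>\<psi>. \<psi> holomorphic_on B \<and> \<psi> ` B \<subseteq> cball z0 r)"
  \<comment> \<open>The integral operator of Picard in differential form: \<open>\<eta>\<close> is
    the primitive of \<open>f s (\<psi> s)\<close> with value \<open>z0\<close> at
    \<open>s0\<close>.\<close>
  define next_of where "next_of = (\<lambda>\<psi> \<eta>. \<eta> s0 = z0 \<and>
      (\<forall>s\<in>B. (\<eta> has_field_derivative f s (\<psi> s)) (at s)))"
  have ex: "\<exists>\<eta>. next_of \<psi> \<eta>" if "good \<psi>" for \<psi>
  proof -
    have "(\<lambda>s. f s (\<psi> s)) holomorphic_on B"
      using hol[OF \<rho>(2), of \<psi>] that by (simp add: good_def B_def)
    then obtain g where g: "\<And>s. s \<in> B \<Longrightarrow> (g has_field_derivative f s (\<psi> s)) (at s within B)"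
      using holomorphic_convex_primitive'[OF B(2,1)] by blast
    have "((\<lambda>s. g s - g s0 + z0) has_field_derivative f s (\<psi> s)) (at s)" if "s \<in> B" for s
      using DERIV_add[OF DERIV_diff[OF g[OF that, unfolded at_within_open[OF that B(1)]] DERIV_const]
          DERIV_const] by simp
    thus ?thesis
      unfolding next_of_def by (intro exI[of _ "\<lambda>s. g s - g s0 + z0"]) auto
  qed
  have good_next: "good \<eta>" and next_bound: "\<And>s. s \<in> B \<Longrightarrow> norm (\<eta> s - z0) \<le> r"
    if "good \<psi>" "next_of \<psi> \<eta>" for \<psi> \<eta>
  proof -
    show bound: "norm (\<eta> s - z0) \<le> r" if s: "s \<in> B" for s
    proof -
      have "norm (\<eta> s - \<eta> s0) \<le> M * norm (s - s0)"
      proof (rule field_differentiable_bound[OF B(2)])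
        fix x assume x: "x \<in> B"
        show "(\<eta> has_field_derivative f x (\<psi> x)) (at x within B)"
          using \<open>next_of \<psi> \<eta>\<close> x by (auto simp: next_of_def intro: has_field_derivative_at_within)
        show "norm (f x (\<psi> x)) \<le> M"
          using \<open>good \<psi>\<close> x B(4) by (intro M) (auto simp: good_def)
      qed (use s B in auto)
      also have "\<dots> \<le> M * \<rho>"
        using dist_B[OF s] M0 by (intro mult_left_mono)
      also have "\<dots> \<le> r"
        by fact
      finally show ?thesis
        using \<open>next_of \<psi> \<eta>\<close> by (simp add: next_of_def)
    qed
    have "\<eta> holomorphic_on B"
      using \<open>next_of \<psi> \<eta>\<close> B(1) by (auto simp: next_of_def holomorphic_on_open)
    thus "good \<eta>"
      using bound by (auto simp: good_def dist_norm norm_minus_commute)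
  qed
  have "good (\<lambda>_. z0)"
    using r by (auto simp: good_def)
  have "\<exists>\<phi>. \<forall>n. (good (\<phi> n) \<and> (n = 0 \<longrightarrow> \<phi> n = (\<lambda>_. z0))) \<and> next_of (\<phi> n) (\<phi> (Suc n))"
  proof (rule dependent_nat_choice[where P = "\<lambda>n \<psi>. good \<psi> \<and> (n = 0 \<longrightarrow> \<psi> = (\<lambda>_. z0))"
        and Q = "\<lambda>n. next_of"])
    show "\<exists>\<psi>. good \<psi> \<and> (0 = 0 \<longrightarrow> \<psi> = (\<lambda>_. z0))"
      using \<open>good (\<lambda>_. z0)\<close> by blast
    fix \<psi> and n :: nat assume "good \<psi> \<and> (n = 0 \<longrightarrow> \<psi> = (\<lambda>_. z0))"
    hence \<psi>: "good \<psi>"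
      by blast
    obtain \<eta> where "next_of \<psi> \<eta>"
      using ex[OF \<psi>] by blast
    with good_next[OF \<psi> this] show "\<exists>\<eta>. (good \<eta> \<and> (Suc n = 0 \<longrightarrow> \<eta> = (\<lambda>_. z0))) \<and> next_of \<psi> \<eta>"
      by blast
  qed
  then obtain \<phi> where "\<forall>n. (good (\<phi> n) \<and> (n = 0 \<longrightarrow> \<phi> n = (\<lambda>_. z0))) \<and> next_of (\<phi> n) (\<phi> (Suc n))"
    by blast
  hence \<phi>: "\<And>n. good (\<phi> n)" "\<phi> 0 = (\<lambda>_. z0)" "\<And>n. next_of (\<phi> n) (\<phi> (Suc n))"
    by auto
  have in_ball: "\<phi> n x \<in> cball z0 r" if "x \<in> B" for n x
    using \<phi>(1)[of n] that unfolding good_def by blast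
  \<comment> \<open>The mean value inequality is used twice: in \<open>z\<close>, to bound the
    difference of the derivatives of consecutive iterates by \<open>L\<close> times the previous
    distance, and in \<open>s\<close>, to integrate this bound over a distance of at most
    \<open>\<rho>\<close>.\<close>
  have step: "norm (\<phi> (Suc n) s - \<phi> n s) \<le> r * (1/2) ^ n" if "s \<in> B" for n s
    using that
  proof (induction n arbitrary: s)
    case 0
    thus ?case
      using next_bound[OF \<phi>(1,3)] by (simp add: \<phi>(2))
  next
    case (Suc n)
    define K where "K = L * (r * (1/2) ^ n)"
    have "norm ((\<phi> (Suc (Suc n)) s - \<phi> (Suc n) s) - (\<phi> (Suc (Suc n)) s0 - \<phi> (Suc n) s0))
        \<le> K * norm (s - s0)"
    proof (rule field_differentiable_bound[OF B(2)])
      fix x assume x: "x \<in> B"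
      have "(\<phi> (Suc (Suc n)) has_field_derivative f x (\<phi> (Suc n) x)) (at x)"
        "(\<phi> (Suc n) has_field_derivative f x (\<phi> n x)) (at x)"
        using \<phi>(3) x by (auto simp: next_of_def)
      thus "((\<lambda>s. \<phi> (Suc (Suc n)) s - \<phi> (Suc n) s) has_field_derivative
          f x (\<phi> (Suc n) x) - f x (\<phi> n x)) (at x within B)"
        by (intro has_field_derivative_at_within[OF DERIV_diff])
      have "norm (f x (\<phi> (Suc n) x) - f x (\<phi> n x)) \<le> L * norm (\<phi> (Suc n) x - \<phi> n x)"
      proof (rule field_differentiable_bound[where S = "cball z0 r"])
        fix z assume "z \<in> cball z0 r"
        moreover have "x \<in> ball s0 r"
          using x B(4) by blast
        ultimately show "(f x has_field_derivative fz x z) (at z within cball z0 r)" "norm (fz x z) \<le> L"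
          using der L by (auto intro: has_field_derivative_at_within)
      qed (use in_ball x in auto)
      also have "\<dots> \<le> K"
        unfolding K_def using Suc.IH[OF x] L0 by (rule mult_left_mono)
      finally show "norm (f x (\<phi> (Suc n) x) - f x (\<phi> n x)) \<le> K" .
    qed (use Suc.prems B in auto)
    also have "\<dots> \<le> K * \<rho>"
      using dist_B[OF Suc.prems] L0 r by (intro mult_left_mono) (auto simp: K_def)
    also have "\<dots> = (L * \<rho>) * (r * (1/2) ^ n)"
      by (simp add: K_def)
    also have "\<dots> \<le> 1 / 2 * (r * (1/2) ^ n)"
      using \<rho>(4) r by (intro mult_right_mono) auto
    finally show ?case
      using \<phi>(3) by (simp add: next_of_def)
  qed
  define g where "g = (\<lambda>s. z0 + (\<Sum>i. \<phi> (Suc i) s - \<phi> i s))"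
  have "uniform_limit B (\<lambda>n s. \<Sum>i<n. \<phi> (Suc i) s - \<phi> i s) (\<lambda>s. \<Sum>i. \<phi> (Suc i) s - \<phi> i s) sequentially"
    using step by (intro Weierstrass_m_test[where M = "\<lambda>n. r * (1/2) ^ n"] summable_mult
        summable_geometric) auto
  hence "uniform_limit B (\<lambda>n s. z0 + (\<Sum>i<n. \<phi> (Suc i) s - \<phi> i s)) g sequentially"
    unfolding g_def by (intro uniform_limit_add uniform_limit_const)
  moreover have "z0 + (\<Sum>i<n. \<phi> (Suc i) s - \<phi> i s) = \<phi> n s" for n s
    by (simp add: sum_lessThan_telescope[of "\<lambda>i. \<phi> i s"] \<phi>(2))
  ultimately have ulim: "uniform_limit B \<phi> g sequentially"
    by simp
  \<comment> \<open>The derivative of iterate \<open>n\<close> is formed with iterate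
    \<open>n - 1\<close>; the initial iterate is constant.\<close>
  define \<phi>' where "\<phi>' = (\<lambda>n s. if n = 0 then 0 else f s (\<phi> (n - 1) s))"
  have "\<exists>g'. \<forall>x\<in>B. (g has_field_derivative g' x) (at x) \<and> ((\<lambda>n. \<phi>' n x) \<longlongrightarrow> g' x) sequentially"
  proof (rule has_complex_derivative_uniform_sequence[OF B(1)])
    fix n x assume "x \<in> B"
    thus "(\<phi> n has_field_derivative \<phi>' n x) (at x)"
      using \<phi>(2) \<phi>(3)[of "n - 1"] by (cases n) (auto simp: \<phi>'_def next_of_def)
  next
    fix x assume "x \<in> B"
    then obtain d where "0 < d" "cball x d \<subseteq> B"
      using B(1) open_contains_cball by blast
    thus "\<exists>d. 0 < d \<and> cball x d \<subseteq> B \<and> uniform_limit (cball x d) \<phi> g sequentially"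
      using uniform_limit_on_subset[OF ulim] by blast
  qed
  then obtain g' where g': "\<And>x. x \<in> B \<Longrightarrow> (g has_field_derivative g' x) (at x)"
      "\<And>x. x \<in> B \<Longrightarrow> (\<lambda>n. \<phi>' n x) \<longlonglongrightarrow> g' x"
    by blast
  have lim: "(\<lambda>n. \<phi> n x) \<longlonglongrightarrow> g x" if "x \<in> B" for x
    using tendsto_uniform_limitI[OF ulim that] .
  \<comment> \<open>The values are confined to a closed ball so that the limit cannot leave the
    region where \<open>f\<close> is controlled.\<close>
  have g_ball: "g x \<in> cball z0 r" if "x \<in> B" for x
    using lim[OF that]
    by (rule Lim_in_closed_set[rotated 3]) (use that in_ball in auto)
  show ?thesis
  proof (rule that[of \<rho> g])
    have "\<phi> n s0 = z0" for n
      using \<phi>(2) \<phi>(3)[of "n - 1"] by (cases n) (auto simp: next_of_def)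
    thus "g s0 = z0"
      using lim[OF B(3)] LIMSEQ_unique tendsto_const by fastforce
    fix s assume "s \<in> ball s0 \<rho>"
    hence s: "s \<in> B"
      by (simp add: B_def)
    show "g s \<in> cball z0 r"
      by (rule g_ball[OF s])
    have "isCont (f s) (g s)"
      using der g_ball[OF s] s B(4) by (blast intro: DERIV_isCont)
    hence "(\<lambda>n. f s (\<phi> n s)) \<longlonglongrightarrow> f s (g s)"
      using lim[OF s] isCont_tendsto_compose by blast
    moreover have "(\<lambda>n. f s (\<phi> n s)) \<longlonglongrightarrow> g' s"
      using LIMSEQ_Suc[OF g'(2)[OF s]] by (simp add: \<phi>'_def)
    ultimately have "g' s = f s (g s)"
      using LIMSEQ_unique by blast
    thus "(g has_field_derivative f s (g s)) (at s)"
      using g'(1)[OF s] by simp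
  qed (use \<rho> in auto)
qed

text \<open>The unknown is the inner variable of \<open>a\<close> and \<open>b\<close>, the
  independent variable the outer one. Since \<open>b\<close> stays nonzero on a compact polydisc
  around \<open>(s0, z0)\<close>, continuity there supplies the bounds needed for Picard
  iteration.\<close>

lemma rational_ode_solution:
  fixes a b :: "complex poly poly"
  assumes "poly2 b z0 s0 \<noteq> 0"
  obtains \<rho> \<phi> where "0 < \<rho>" "\<phi> s0 = z0"
    "\<And>s. s \<in> ball s0 \<rho> \<Longrightarrow> poly2 b (\<phi> s) s \<noteq> 0"
    "\<And>s. s \<in> ball s0 \<rho> \<Longrightarrow> (\<phi> has_field_derivative poly2 a (\<phi> s) s / poly2 b (\<phi> s) s) (at s)"
proof -
  have cont: "continuous_on X (\<lambda>x. poly2 P (snd x) (fst x))" for X and P :: "complex poly poly"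
    by (induction P) (simp_all add: continuous_on_add continuous_on_mult continuous_on_poly
        continuous_on_fst continuous_on_snd)
  have "open {x. poly2 b (snd x) (fst x) \<noteq> 0}"
    by (intro open_Collect_neq cont continuous_on_const)
  moreover have "(s0, z0) \<in> {x. poly2 b (snd x) (fst x) \<noteq> 0}"
    using assms by simp
  ultimately obtain e where e: "0 < e" "ball (s0, z0) e \<subseteq> {x. poly2 b (snd x) (fst x) \<noteq> 0}"
    by (rule openE)
  \<comment> \<open>The product distance is at most the sum of two distances up to \<open>r\<close>,
    and \<open>2 * e / 3 < e\<close>.\<close>
  define r where "r = e / 3"
  have r: "0 < r"
    using e by (simp add: r_def)
  define K where "K = cball s0 r \<times> cball z0 r"
  have "compact K"
    unfolding K_def by (intro compact_Times compact_cball)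
  have nz: "poly2 b z s \<noteq> 0" if "s \<in> cball s0 r" "z \<in> cball z0 r" for s z
  proof -
    have "dist (s0, z0) (s, z) \<le> dist s0 s + dist z0 z"
      unfolding dist_prod_def by (rule order_trans[OF sqrt_sum_squares_le_sum]) auto
    also have "\<dots> < e"
      using that e(1) by (auto simp: r_def)
    finally show ?thesis
      using e(2) by auto
  qed
  define f where "f = (\<lambda>s z. poly2 a z s / poly2 b z s)"
  define fz where "fz = (\<lambda>s z. (poly2 (map_poly pderiv a) z s * poly2 b z s
      - poly2 a z s * poly2 (map_poly pderiv b) z s) / (poly2 b z s * poly2 b z s))"
  have "continuous_on K (\<lambda>x. f (fst x) (snd x))" "continuous_on K (\<lambda>x. fz (fst x) (snd x))"
    unfolding f_def fz_def using nz
    by (auto intro!: continuous_on_divide continuous_on_mult continuous_on_diff cont simp: K_def)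
  then have "bounded ((\<lambda>x. f (fst x) (snd x)) ` K)" "bounded ((\<lambda>x. fz (fst x) (snd x)) ` K)"
    using \<open>compact K\<close> by (auto intro: compact_imp_bounded compact_continuous_image)
  then obtain M L where M: "\<forall>x\<in>K. norm (f (fst x) (snd x)) \<le> M"
    and L: "\<forall>x\<in>K. norm (fz (fst x) (snd x)) \<le> L"
    by (auto simp: bounded_iff)
  show ?thesis
  proof (rule picard_holomorphic[OF r, of s0 z0 f M fz L])
    fix s z assume sz: "s \<in> ball s0 r" "z \<in> cball z0 r"
    hence K: "(s, z) \<in> K"
      by (auto simp: K_def)
    show "norm (f s z) \<le> M" "norm (fz s z) \<le> L"
      using M L K by force+
    have b: "poly2 b z s \<noteq> 0"
      using nz sz by auto
    show "(f s has_field_derivative fz s z) (at z)"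
      unfolding f_def fz_def
      using DERIV_divide[OF poly2_has_field_derivative[OF DERIV_ident DERIV_const]
          poly2_has_field_derivative[OF DERIV_ident DERIV_const] b] by simp
  next
    fix \<psi> \<rho> assume \<psi>: "\<rho> \<le> r" "\<psi> holomorphic_on ball s0 \<rho>" "\<psi> ` ball s0 \<rho> \<subseteq> cball z0 r"
    have "(\<lambda>s. poly2 P (\<psi> s) s) holomorphic_on ball s0 \<rho>" for P
      using poly2_has_field_derivative[OF holomorphic_derivI[OF \<psi>(2) open_ball] DERIV_ident]
      unfolding holomorphic_on_open[OF open_ball] by blast
    thus "(\<lambda>s. f s (\<psi> s)) holomorphic_on ball s0 \<rho>"
      unfolding f_def using \<psi>(1,3) by (intro holomorphic_intros nz) (auto simp: image_subset_iff)
  next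
    fix \<rho> \<phi> assume "0 < \<rho>" "\<rho> \<le> r" "\<phi> s0 = z0"
      and \<phi>: "\<And>s. s \<in> ball s0 \<rho> \<Longrightarrow> \<phi> s \<in> cball z0 r"
        "\<And>s. s \<in> ball s0 \<rho> \<Longrightarrow> (\<phi> has_field_derivative f s (\<phi> s)) (at s)"
    show ?thesis
      by (rule that[of \<rho> \<phi>])
        (use \<phi> nz \<open>0 < \<rho>\<close> \<open>\<rho> \<le> r\<close> \<open>\<phi> s0 = z0\<close> in \<open>auto simp: f_def\<close>)
  qed
qed

section \<open>Analytic curves with a vertical tangent\<close>

text \<open>Zeros of a holomorphic function are isolated unless it vanishes identically. The first
  alternative is kept on the whole ball so that it can be refuted by differentiating.\<close>

lemma holomorphic_zero_dichotomy:
  assumes "f holomorphic_on ball s0 \<rho>" "0 < \<rho>"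
  shows "(\<forall>s\<in>ball s0 \<rho>. f s = 0) \<or> (\<forall>\<^sub>F s in at s0. f s \<noteq> 0)"
proof (cases "f s0 = 0")
  case True
  show ?thesis
  proof (cases "\<forall>s\<in>ball s0 \<rho>. f s = 0")
    case False
    then obtain \<beta> where "\<beta> \<in> ball s0 \<rho>" "f \<beta> \<noteq> 0"
      by blast
    then obtain r where r: "0 < r" "\<And>z. z \<in> ball s0 r - {s0} \<Longrightarrow> f z \<noteq> 0"
      using isolated_zeros[OF assms(1) open_ball connected_ball, of s0 \<beta>] True assms(2)
      by (metis centre_in_ball)
    have "\<forall>\<^sub>F s in at s0. f s \<noteq> 0"
      by (rule eventually_mono[OF eventually_at_in_open[OF open_ball, of s0 s0 r]]) (use r in auto)
    thus ?thesis ..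
  qed auto
next
  case False
  have "isCont f s0"
    using assms by (metis centre_in_ball continuous_on_interior holomorphic_on_imp_continuous_on
        interior_open open_ball)
  thus ?thesis
    using False tendsto_imp_eventually_ne unfolding isCont_def by blast
qed

text \<open>Here \<open>c\<close> comes from a Bezout identity between \<open>p\<close> and its
  derivative in \<open>t\<close>, much like a discriminant (or \<open>c = p\<close> if
  \<open>t\<close> does not occur). If \<open>p\<close> vanished along \<open>z = \<phi> s\<close>,
  differentiating at \<open>t0\<close> with \<open>\<phi>'(t0) = 0\<close> would leave the
  \<open>t\<close>-derivative of \<open>p\<close> equal to 0; together with \<open>p = 0\<close>
  this gives \<open>c(\<phi> t0) = 0\<close>.\<close>

lemma transversality_prime:
  fixes p :: "complex poly poly"
  assumes "prime p"
  obtains c where "c \<noteq> 0"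
    "\<And>\<phi> t0 \<rho>. 0 < \<rho> \<Longrightarrow> \<phi> holomorphic_on ball t0 \<rho> \<Longrightarrow> poly c (\<phi> t0) \<noteq> 0 \<Longrightarrow> deriv \<phi> t0 = 0 \<Longrightarrow>
      (\<forall>\<^sub>F s in at t0. poly2 p (\<phi> s) s \<noteq> 0)"
proof -
  have "\<exists>a b c. c \<noteq> 0 \<and> a * p + b * pderiv p = [:c:]"
  proof (cases "degree p = 0")
    case True
    then obtain c where "p = [:c:]"
      by (rule degree_eq_zeroE)
    thus ?thesis
      using assms by (intro exI[of _ 1] exI[of _ 0] exI[of _ c]) auto
  next
    case False
    hence "pderiv p \<noteq> 0"
      by (simp add: pderiv_eq_0_iff)
    hence "\<not> p dvd pderiv p"
      using False dvd_imp_degree_le[of p "pderiv p"] by (auto simp: degree_pderiv)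
    hence "coprime p (pderiv p)"
      using assms by (intro prime_elem_imp_coprime) auto
    thus ?thesis
      using coprime_bezout_const[of p "pderiv p"] assms by (metis not_prime_0)
  qed
  then obtain a b c where c: "c \<noteq> 0" "a * p + b * pderiv p = [:c:]"
    by blast
  show ?thesis
  proof (rule that[OF c(1)])
    fix \<phi> t0 \<rho> assume \<rho>: "0 < (\<rho> :: real)" and hol: "\<phi> holomorphic_on ball t0 \<rho>"
      and nz: "poly c (\<phi> t0) \<noteq> 0" and der: "deriv \<phi> t0 = 0"
    define g where "g = (\<lambda>s. poly2 p (\<phi> s) s)"
    have g': "(g has_field_derivative
        poly2 (map_poly pderiv p) (\<phi> s) s * deriv \<phi> s + poly2 (pderiv p) (\<phi> s) s) (at s)"
      if "s \<in> ball t0 \<rho>" for s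
      using poly2_has_field_derivative[OF holomorphic_derivI[OF hol open_ball that] DERIV_ident]
      by (simp add: g_def)
    have "g holomorphic_on ball t0 \<rho>"
      unfolding holomorphic_on_open[OF open_ball] using g' by blast
    moreover have False if zero: "\<forall>s\<in>ball t0 \<rho>. g s = 0"
    proof -
      have "((\<lambda>_. 0) has_field_derivative poly2 (pderiv p) (\<phi> t0) t0) (at t0)"
        by (rule has_field_derivative_transform_within_open[of g _ _ "ball t0 \<rho>"])
          (use g'[of t0] zero \<rho> der in auto)
      hence "poly2 (pderiv p) (\<phi> t0) t0 = 0"
        using DERIV_unique DERIV_const by blast
      moreover have "poly2 p (\<phi> t0) t0 = 0"
        using zero \<rho> by (auto simp: g_def)
      ultimately have "poly2 [:c:] (\<phi> t0) t0 = 0"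
        unfolding c(2)[symmetric] by (simp add: poly2_add poly2_mult)
      thus False
        using nz by simp
    qed
    ultimately show "\<forall>\<^sub>F s in at t0. poly2 p (\<phi> s) s \<noteq> 0"
      using holomorphic_zero_dichotomy[of g t0 \<rho>] \<rho> unfolding g_def by blast
  qed
qed

text \<open>
  Over all but finitely many \<open>z0\<close> the curve \<open>N = 0\<close> is locally a union of graphs over the
  \<open>z\<close>-axis, so it does not contain the curve \<open>z = \<phi> s\<close>, whose tangent is \<open>z = z0\<close>.
\<close>

lemma transversality:
  fixes N :: "complex poly poly"
  assumes "N \<noteq> 0"
  obtains c where "c \<noteq> 0"
    "\<And>\<phi> t0 \<rho>. 0 < \<rho> \<Longrightarrow> \<phi> holomorphic_on ball t0 \<rho> \<Longrightarrow> poly c (\<phi> t0) \<noteq> 0 \<Longrightarrow> deriv \<phi> t0 = 0 \<Longrightarrow>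
      (\<forall>\<^sub>F s in at t0. poly2 N (\<phi> s) s \<noteq> 0)"
proof -
  define good where "good = (\<lambda>(N :: complex poly poly) c. c \<noteq> 0 \<and>
    (\<forall>\<phi> t0 \<rho>. 0 < \<rho> \<and> \<phi> holomorphic_on ball t0 \<rho> \<and> poly c (\<phi> t0) \<noteq> 0 \<and> deriv \<phi> t0 = 0 \<longrightarrow>
      (\<forall>\<^sub>F s in at t0. poly2 N (\<phi> s) s \<noteq> 0)))"
  have "N \<noteq> 0 \<longrightarrow> (\<exists>c. good N c)"
  \<comment> \<open>A repeated factor of \<open>N\<close> is shared with its derivative, so the
    Bezout argument works only for primes; the exceptional polynomials of the factors are
    multiplied.\<close>
  proof (induction N rule: prime_divisors_induct)
    case (unit N)
    then obtain a where a: "N = [:a:]" "is_unit a"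
      by (auto simp: is_unit_poly_iff)
    then obtain b where "a = [:b:]" "b \<noteq> 0"
      by (metis is_unit_poly_iff not_is_unit_0 pCons_0_0)
    with a have "good N 1"
      by (auto simp: good_def)
    thus ?case
      by blast
  next
    case (factor p N)
    show ?case
    proof
      assume "p * N \<noteq> 0"
      then obtain c where c: "good N c"
        using factor.IH by auto
      obtain d where d: "d \<noteq> 0"
        "\<And>\<phi> t0 \<rho>. 0 < \<rho> \<Longrightarrow> \<phi> holomorphic_on ball t0 \<rho> \<Longrightarrow> poly d (\<phi> t0) \<noteq> 0 \<Longrightarrow> deriv \<phi> t0 = 0 \<Longrightarrow>
          (\<forall>\<^sub>F s in at t0. poly2 p (\<phi> s) s \<noteq> 0)"
        using transversality_prime[OF factor.hyps(1)] by blast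
      have "good (p * N) (d * c)"
        unfolding good_def
      proof (intro conjI allI impI)
        show "d * c \<noteq> 0"
          using c d by (auto simp: good_def)
        fix \<phi> t0 \<rho>
        assume *: "0 < (\<rho> :: real) \<and> \<phi> holomorphic_on ball t0 \<rho> \<and> poly (d * c) (\<phi> t0) \<noteq> 0 \<and> deriv \<phi> t0 = 0"
        have "\<forall>\<^sub>F s in at t0. poly2 p (\<phi> s) s \<noteq> 0"
          by (rule d(2)[of \<rho>]) (use * in auto)
        moreover have "\<forall>\<^sub>F s in at t0. poly2 N (\<phi> s) s \<noteq> 0"
        proof -
          have "0 < \<rho> \<and> \<phi> holomorphic_on ball t0 \<rho> \<and> poly c (\<phi> t0) \<noteq> 0 \<and> deriv \<phi> t0 = 0"
            using * by auto
          thus ?thesis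
            using c unfolding good_def by blast
        qed
        ultimately show "\<forall>\<^sub>F s in at t0. poly2 (p * N) (\<phi> s) s \<noteq> 0"
          by eventually_elim (simp add: poly2_mult)
      qed
      thus "\<exists>c. good (p * N) c"
        by blast
    qed
  qed simp
  then obtain c where "good N c"
    using assms by blast
  show ?thesis
    by (rule that[of c]) (use \<open>good N c\<close> in \<open>unfold good_def, blast+\<close>)
qed

section \<open>Continuation along the image of a curve\<close>

text \<open>Germs of meromorphic functions are compared on punctured neighbourhoods, so to pull such
  a comparison back along \<open>\<phi>\<close> one needs \<open>\<phi>\<close> not to return to the
  value \<open>\<phi> s\<close> near \<open>s\<close>. This holds as \<open>\<phi>\<close> is not
  locally constant.\<close>

lemma filterlim_at_if_deriv_nonzero:
  assumes "\<phi> holomorphic_on ball s0 \<rho>" "\<And>s. s \<in> ball s0 \<rho> - {s0} \<Longrightarrow> deriv \<phi> s \<noteq> 0"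
    and "s \<in> ball s0 \<rho>"
  shows "filterlim \<phi> (at (\<phi> s)) (at s)"
proof -
  have "isCont \<phi> s"
    using assms(1,3) by (metis continuous_on_interior holomorphic_on_imp_continuous_on
        interior_open open_ball)
  obtain e where e: "0 < e" "ball s e \<subseteq> ball s0 \<rho>"
    using assms(3) openE[OF open_ball] by blast
  have False if const: "\<forall>x\<in>ball s e. \<phi> x - \<phi> s = 0"
  proof -
    \<comment> \<open>At \<open>s0\<close> the derivative may vanish, so the contradiction is sought
      at a nearby point in the case \<open>s = s0\<close>.\<close>
    obtain x where x: "x \<in> ball s e" "x \<noteq> s0"
    proof (cases "s = s0")
      case True
      thus ?thesis
        using that[of "s + of_real (e / 2)"] e(1) by (simp add: dist_norm)
    next
      case False
      thus ?thesis
        using that[of s] e(1) by simp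
    qed
    have "(\<phi> has_field_derivative 0) (at x)"
      by (rule has_field_derivative_transform_within_open[OF DERIV_const[of "\<phi> s"] open_ball[of s e]])
        (use x const in auto)
    thus False
      using DERIV_imp_deriv assms(2)[of x] x e(2) by blast
  qed
  moreover have "(\<lambda>x. \<phi> x - \<phi> s) holomorphic_on ball s e"
    using assms(1) e(2) by (intro holomorphic_intros) (auto intro: holomorphic_on_subset)
  ultimately have "\<forall>\<^sub>F x in at s. \<phi> x - \<phi> s \<noteq> 0"
    using holomorphic_zero_dichotomy e(1) by blast
  thus ?thesis
    using \<open>isCont \<phi> s\<close> by (simp add: filterlim_at isCont_def)
qed

lemma meromorphic_on_eventually_analytic:
  assumes "f meromorphic_on {z}"
  shows "\<forall>\<^sub>F x in at z. f analytic_on {x}"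
proof -
  obtain r where "0 < r" "f analytic_on ball z r - {z}"
    using meromorphic_on_isolated_singularity[OF assms] unfolding isolated_singularity_at_def by blast
  thus ?thesis
    using eventually_at_in_open[OF open_ball, of z z r]
    by (auto elim!: eventually_mono intro: analytic_on_subset)
qed

text \<open>The identity theorem is applied upstairs, in the parameter \<open>s\<close>, where
  \<open>W\<close> is single-valued although \<open>\<phi>\<close> need not be injective. Agreement
  of \<open>f \<tau> \<circ> \<phi>\<close> with \<open>W\<close> near the point of parameter
  \<open>\<tau>\<close> is a locally constant property of \<open>\<tau>\<close>, and
  \<open>[0,1]\<close> is connected.\<close>

lemma continuation_pullback:
  assumes \<phi>: "\<phi> holomorphic_on ball s0 \<rho>" "\<And>s. s \<in> ball s0 \<rho> - {s0} \<Longrightarrow> deriv \<phi> s \<noteq> 0"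
    and W: "W holomorphic_on ball s0 \<rho> - {s0}"
    and s1: "s1 \<in> ball s0 \<rho>"
    and mero: "\<And>\<tau>. \<tau> \<in> {0..1} \<Longrightarrow> f \<tau> meromorphic_on {\<phi> (linepath s1 s0 \<tau>)}"
    and loc: "\<And>\<tau>. \<tau> \<in> {0..1} \<Longrightarrow> \<forall>\<^sub>F \<tau>' in at \<tau> within {0..1}.
        \<forall>\<^sub>F z in at (\<phi> (linepath s1 s0 \<tau>')). f \<tau>' z = f \<tau> z"
    and start: "\<forall>\<^sub>F s in at s1. f 0 (\<phi> s) = W s"
  shows "\<forall>\<^sub>F s in at s0. f 1 (\<phi> s) = W s"
proof -
  define \<sigma> where "\<sigma> = linepath s1 s0"
  define G where "G = (\<lambda>\<tau>. \<forall>\<^sub>F s in at (\<sigma> \<tau>). f \<tau> (\<phi> s) = W s)"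
  have "0 < \<rho>"
    using s1 le_less_trans[OF zero_le_dist] by simp
  have \<sigma>_in: "\<sigma> \<tau> \<in> ball s0 \<rho>" if "\<tau> \<in> {0..1}" for \<tau>
  proof -
    have "\<sigma> \<tau> \<in> closed_segment s1 s0"
      using that linepath_in_path[of \<tau> s1 s0] by (simp add: \<sigma>_def)
    also have "\<dots> \<subseteq> ball s0 \<rho>"
      using s1 \<open>0 < \<rho>\<close> by (intro closed_segment_subset convex_ball) auto
    finally show ?thesis .
  qed
  have lim: "filterlim \<phi> (at (\<phi> (\<sigma> \<tau>))) (at (\<sigma> \<tau>))" if "\<tau> \<in> {0..1}" for \<tau>
    using filterlim_at_if_deriv_nonzero[OF \<phi> \<sigma>_in[OF that]] by blast
  have "\<forall>\<^sub>F \<tau>' in at \<tau> within {0..1}. G \<tau> = G \<tau>'" if \<tau>: "\<tau> \<in> {0..1}" for \<tau>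
  proof -
    have "\<forall>\<^sub>F s in at (\<sigma> \<tau>). f \<tau> analytic_on {\<phi> s}"
      using eventually_compose_filterlim[OF meromorphic_on_eventually_analytic lim[OF \<tau>]]
        mero[OF \<tau>] by (simp add: \<sigma>_def)
    moreover have "\<forall>\<^sub>F s in at (\<sigma> \<tau>). s \<in> ball s0 \<rho>"
      using \<sigma>_in[OF \<tau>] by (intro eventually_at_in_open') auto
    moreover have "\<forall>\<^sub>F s in at (\<sigma> \<tau>). s \<noteq> s0"
      by (simp add: eventually_neq_at_within)
    ultimately have "\<forall>\<^sub>F s in at (\<sigma> \<tau>). s \<in> ball s0 \<rho> - {s0} \<and> f \<tau> analytic_on {\<phi> s}"
      by eventually_elim auto
    then obtain \<delta> where \<delta>: "0 < \<delta>"
      "\<And>s. s \<noteq> \<sigma> \<tau> \<Longrightarrow> dist s (\<sigma> \<tau>) < \<delta> \<Longrightarrow> s \<in> ball s0 \<rho> - {s0} \<and> f \<tau> analytic_on {\<phi> s}"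
      unfolding eventually_at by blast
    \<comment> \<open>The centre is removed because \<open>f \<tau>\<close> may have a pole there,
      or because it is \<open>s0\<close>, where nothing is assumed about \<open>W\<close>. The
      punctured disc is still connected, as the identity theorem requires.\<close>
    define D where "D = ball (\<sigma> \<tau>) \<delta> - {\<sigma> \<tau>}"
    have D_good: "s \<in> ball s0 \<rho> - {s0}" "f \<tau> analytic_on {\<phi> s}" if "s \<in> D" for s
      using \<delta>(2)[of s] that by (simp_all add: D_def dist_commute)
    have D: "open D" "connected D" "D \<subseteq> ball s0 \<rho> - {s0}"
      using D_good(1) by (simp_all add: D_def connected_punctured_ball open_delete subset_iff)
    have hol_W: "W holomorphic_on D"
      using W D(3) by (rule holomorphic_on_subset)
    have "(f \<tau> \<circ> \<phi>) analytic_on D"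
    proof (rule analytic_on_compose)
      show "\<phi> analytic_on D"
        using \<phi>(1) D(3) analytic_on_open[OF open_ball] by (blast intro: analytic_on_subset)
      show "f \<tau> analytic_on \<phi> ` D"
        using D_good(2) by (subst analytic_on_analytic_at) blast
    qed
    hence hol_f: "(\<lambda>s. f \<tau> (\<phi> s)) holomorphic_on D"
      using analytic_imp_holomorphic by (auto simp: o_def)
    \<comment> \<open>Agreement near one point of the disc is agreement on all of \<open>D\<close>,
      so it does not matter which nearby \<open>\<tau>'\<close> is used to test it.\<close>
    have key: "(\<forall>\<^sub>F s in at (\<sigma> \<tau>'). f \<tau> (\<phi> s) = W s) \<longleftrightarrow> (\<forall>s\<in>D. f \<tau> (\<phi> s) = W s)"
      if \<tau>': "\<sigma> \<tau>' \<in> ball (\<sigma> \<tau>) \<delta>" for \<tau>'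
    proof -
      have in_D: "\<forall>\<^sub>F s in at (\<sigma> \<tau>'). s \<in> D"
      proof -
        have "\<forall>\<^sub>F s in at (\<sigma> \<tau>'). s \<in> ball (\<sigma> \<tau>) \<delta>"
          using \<tau>' by (intro eventually_at_in_open') auto
        moreover have "\<forall>\<^sub>F s in at (\<sigma> \<tau>'). s \<noteq> \<sigma> \<tau>"
          by (simp add: eventually_neq_at_within)
        ultimately show ?thesis
          by eventually_elim (auto simp: D_def)
      qed
      show ?thesis
      proof
        assume "\<forall>s\<in>D. f \<tau> (\<phi> s) = W s"
        thus "\<forall>\<^sub>F s in at (\<sigma> \<tau>'). f \<tau> (\<phi> s) = W s"
          using in_D by (auto elim: eventually_mono)
      next
        assume "\<forall>\<^sub>F s in at (\<sigma> \<tau>'). f \<tau> (\<phi> s) = W s"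
        with in_D have "\<forall>\<^sub>F s in at (\<sigma> \<tau>'). s \<in> D \<and> f \<tau> (\<phi> s) = W s"
          by eventually_elim auto
        then obtain A where A: "open A" "\<sigma> \<tau>' \<in> A" "\<forall>s\<in>A. s \<noteq> \<sigma> \<tau>' \<longrightarrow> s \<in> D \<and> f \<tau> (\<phi> s) = W s"
          unfolding eventually_at_topological by blast
        have "A - {\<sigma> \<tau>'} \<noteq> {}"
          using A(1,2) not_open_singleton[of "\<sigma> \<tau>'"] by (auto simp: subset_singleton_iff)
        show "\<forall>s\<in>D. f \<tau> (\<phi> s) = W s"
        proof
          fix s assume "s \<in> D"
          show "f \<tau> (\<phi> s) = W s"
            by (rule analytic_continuation_open[of "A - {\<sigma> \<tau>'}" D "\<lambda>s. f \<tau> (\<phi> s)" W])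
              (use A D hol_f hol_W \<open>s \<in> D\<close> \<open>A - {\<sigma> \<tau>'} \<noteq> {}\<close> in auto)
        qed
      qed
    qed
    have "continuous_on UNIV \<sigma>"
      unfolding \<sigma>_def by (intro continuous_on_linepath)
    hence "(\<sigma> \<longlongrightarrow> \<sigma> \<tau>) (at \<tau> within UNIV)"
      unfolding continuous_on_def by blast
    hence "(\<sigma> \<longlongrightarrow> \<sigma> \<tau>) (at \<tau> within {0..1})"
      by (rule tendsto_within_subset) simp
    hence "\<forall>\<^sub>F \<tau>' in at \<tau> within {0..1}. \<sigma> \<tau>' \<in> ball (\<sigma> \<tau>) \<delta>"
      by (rule topological_tendstoD) (use \<delta>(1) in auto)
    moreover have "\<forall>\<^sub>F \<tau>' in at \<tau> within {0..1}. \<tau>' \<in> {0..1}"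
      by (simp add: eventually_at_filter)
    ultimately show ?thesis
      using loc[OF \<tau>]
    proof eventually_elim
      case (elim \<tau>')
      have "\<forall>\<^sub>F s in at (\<sigma> \<tau>'). f \<tau>' (\<phi> s) = f \<tau> (\<phi> s)"
        using eventually_compose_filterlim[OF elim(3)[folded \<sigma>_def] lim[OF elim(2)]] .
      hence "\<forall>\<^sub>F s in at (\<sigma> \<tau>'). (f \<tau>' (\<phi> s) = W s) = (f \<tau> (\<phi> s) = W s)"
        by eventually_elim simp
      hence "G \<tau>' = (\<forall>\<^sub>F s in at (\<sigma> \<tau>'). f \<tau> (\<phi> s) = W s)"
        unfolding G_def by (rule eventually_subst)
      also have "\<dots> = G \<tau>"
        unfolding G_def key[OF elim(1)] by (rule key[symmetric]) (use \<delta>(1) in simp)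
      finally show ?case
        by simp
    qed
  qed
  moreover have "connected {0..1 :: real}"
    by simp
  ultimately have "G 0 = G 1"
    by (intro connected_local_const[of "{0..1}" 0 1 G]) auto
  thus ?thesis
    using start by (simp add: G_def \<sigma>_def linepath_0' linepath_1')
qed

section \<open>A curve of solutions with a critical point of the independent variable\<close>

text \<open>The matrix of \<open>no_movable_critical_point\<close> with the finite set exposed,
  since the critical value \<open>z0\<close> must be chosen outside it.\<close>

definition critical_points_within :: "complex poly fract poly poly \<Rightarrow> complex set \<Rightarrow> bool" where
  "critical_points_within F S \<longleftrightarrow> finite S \<and>
     (\<forall>z0 w \<gamma>. z0 \<notin> S \<and> solution_germ F w z0 \<and>
         path \<gamma> \<and> pathstart \<gamma> = z0 \<and> path_image \<gamma> \<inter> S = {}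
       \<longrightarrow> (\<exists>f. meromorphic_continuation w \<gamma> f))"

text \<open>All conditions on \<open>T\<close> are imposed on the punctured disc only, so that
  finite points (\<open>T\<close> the identity) and the point at infinity (\<open>T\<close> the
  inversion) are treated alike. The continuation forces \<open>T s\<close> to depend on
  \<open>\<phi> s\<close> alone; as \<open>T\<close> is injective, so is \<open>\<phi>\<close>,
  against \<open>deriv \<phi> s0 = 0\<close>.\<close>

lemma critical_curve_contradiction:
  assumes S: "critical_points_within F S"
    and F: "poly2 (map_poly2 embed_z F) r1 r2 = 0"
    and var_t: "var_t = poly2 (map_poly2 embed_z P) r1 r2 / poly2 (map_poly2 embed_z Q) r1 r2"
    and \<rho>: "0 < \<rho>"
    and \<phi>: "\<phi> holomorphic_on ball s0 \<rho>" "\<phi> s0 \<notin> S" "deriv \<phi> s0 = 0"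
    and T: "T holomorphic_on ball s0 \<rho> - {s0}" "inj_on T (ball s0 \<rho> - {s0})"
    and gen: "\<And>s. s \<in> ball s0 \<rho> - {s0} \<Longrightarrow> deriv \<phi> s \<noteq> 0 \<and>
      ratfun2_regular r1 (T s) (\<phi> s) \<and> ratfun2_regular r2 (T s) (\<phi> s) \<and>
      (\<forall>i j. ratfun_regular (coeff (coeff F i) j) (\<phi> s)) \<and>
      (\<forall>i j. ratfun_regular (coeff (coeff P i) j) (\<phi> s)) \<and>
      (\<forall>i j. ratfun_regular (coeff (coeff Q i) j) (\<phi> s)) \<and>
      ratfun2_eval (poly2 (map_poly2 embed_z Q) r1 r2) (T s) (\<phi> s) \<noteq> 0"
    and ode: "\<And>s. s \<in> ball s0 \<rho> - {s0} \<Longrightarrow>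
      ratfun2_eval (deriv_t r1) (T s) (\<phi> s) * deriv T s
        = (ratfun2_eval r2 (T s) (\<phi> s) - ratfun2_eval (deriv_z r1) (T s) (\<phi> s)) * deriv \<phi> s"
  shows False
proof -
  have "isCont \<phi> s0"
    using \<phi>(1) \<rho> by (metis centre_in_ball continuous_on_interior holomorphic_on_imp_continuous_on
        interior_open open_ball)
  moreover have "open (- S)"
    using S by (simp add: critical_points_within_def finite_imp_closed open_Compl)
  ultimately have "\<forall>\<^sub>F s in at s0. \<phi> s \<in> - S"
    using \<phi>(2) unfolding isCont_def by (intro topological_tendstoD) auto
  then obtain \<rho>' where \<rho>': "0 < \<rho>'" "\<And>s. s \<noteq> s0 \<Longrightarrow> dist s s0 < \<rho>' \<Longrightarrow> \<phi> s \<notin> S"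
    unfolding eventually_at by auto
  define B where "B = ball s0 (min \<rho> \<rho>')"
  have B: "open B" "s0 \<in> B" "B \<subseteq> ball s0 \<rho>" "convex B"
    using \<rho> \<rho>'(1) by (auto simp: B_def)
  have \<phi>_S: "\<phi> s \<notin> S" if "s \<in> B" for s
    using \<rho>'(2)[of s] \<phi>(2) that by (cases "s = s0") (auto simp: B_def dist_commute)
  have open_B: "open (B - {s0})"
    using B(1) by (rule open_delete)
  have sub: "s \<in> ball s0 \<rho> - {s0}" if "s \<in> B - {s0}" for s
    using that B(3) by blast
  \<comment> \<open>\<open>W\<close> and \<open>V\<close> are \<open>w\<close> and \<open>w'\<close>
    as functions of \<open>s\<close>; the equation for \<open>T\<close> turns into the chain rule
    \<open>W' = V \<phi>'\<close>.\<close>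
  define W where "W = (\<lambda>s. ratfun2_eval r1 (T s) (\<phi> s))"
  define V where "V = (\<lambda>s. ratfun2_eval r2 (T s) (\<phi> s))"
  have \<phi>': "(\<phi> has_field_derivative deriv \<phi> s) (at s)" if "s \<in> B" for s
    using holomorphic_derivI[OF \<phi>(1) open_ball] that B(3) by blast
  have W': "(W has_field_derivative V s * deriv \<phi> s) (at s)" if s: "s \<in> B - {s0}" for s
  proof -
    have "(T has_field_derivative deriv T s) (at s)"
      using holomorphic_derivI[OF T(1) open_delete[OF open_ball] sub[OF s]] .
    hence "(W has_field_derivative ratfun2_eval (deriv_t r1) (T s) (\<phi> s) * deriv T s
        + ratfun2_eval (deriv_z r1) (T s) (\<phi> s) * deriv \<phi> s) (at s)"
      unfolding W_def using gen[OF sub[OF s]] s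
      by (intro ratfun2_eval_has_field_derivative \<phi>') auto
    also have "ratfun2_eval (deriv_t r1) (T s) (\<phi> s) * deriv T s
        + ratfun2_eval (deriv_z r1) (T s) (\<phi> s) * deriv \<phi> s = V s * deriv \<phi> s"
      unfolding ode[OF sub[OF s]] V_def by (simp add: algebra_simps)
    finally show ?thesis .
  qed
  have W_hol: "W holomorphic_on B - {s0}"
    unfolding holomorphic_on_open[OF open_B] using W' by blast
  have F_eq: "poly2 (ode_at F (\<phi> s)) (W s) (V s) = 0" if "s \<in> B - {s0}" for s
    using poly2_embed_z_regular_eval(2)[of F "\<phi> s" r1 "T s" r2] gen[OF sub[OF that]] F
    by (simp add: W_def V_def ratfun2.val_0)
  \<comment> \<open>The inversion formula for \<open>t\<close>, evaluated at points.\<close>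
  define H where "H = (\<lambda>z w v. poly2 (ode_at P z) w v / poly2 (ode_at Q z) w v)"
  have T_eq: "T s = H (\<phi> s) (W s) (V s)" if "s \<in> B - {s0}" for s
  proof -
    note g = gen[OF sub[OF that]]
    have "T s = ratfun2_eval var_t (T s) (\<phi> s)"
      by (simp add: var_t_regular_eval)
    also have "\<dots> = H (\<phi> s) (W s) (V s)"
      unfolding var_t H_def W_def V_def
      using poly2_embed_z_regular_eval[of P "\<phi> s" r1 "T s" r2]
        poly2_embed_z_regular_eval[of Q "\<phi> s" r1 "T s" r2] g
      by (subst ratfun2.val_divide) auto
    finally show ?thesis .
  qed

  have "s0 + of_real (min \<rho> \<rho>' / 2) \<in> B - {s0}"
    using \<rho> \<rho>'(1) by (cases "\<rho> \<le> \<rho>'") (auto simp: B_def dist_norm min_def)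
  then obtain s1 where s1: "s1 \<in> B - {s0}"
    by blast
  have "\<phi> holomorphic_on B - {s0}"
    using \<phi>(1) B(3) by (blast intro: holomorphic_on_subset)
  then obtain e where e: "0 < e" "ball s1 e \<subseteq> B - {s0}" "open (\<phi> ` ball s1 e)" "inj_on \<phi> (ball s1 e)"
    using has_complex_derivative_locally_invertible[OF _ s1 open_B] gen[OF sub[OF s1]] by blast
  have \<phi>_e: "\<phi> holomorphic_on ball s1 e"
    using \<open>\<phi> holomorphic_on B - {s0}\<close> e(2) by (rule holomorphic_on_subset)
  obtain \<psi> where \<psi>: "\<psi> holomorphic_on (\<phi> ` ball s1 e)"
    "\<And>s. s \<in> ball s1 e \<Longrightarrow> deriv \<phi> s * deriv \<psi> (\<phi> s) = 1"
    "\<And>s. s \<in> ball s1 e \<Longrightarrow> \<psi> (\<phi> s) = s"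
    using holomorphic_has_inverse[OF \<phi>_e open_ball e(4)] by blast
  \<comment> \<open>Away from \<open>s0\<close> the map \<open>\<phi>\<close> has a local inverse
    \<open>\<psi>\<close>, through which \<open>W\<close> becomes a function of
    \<open>z\<close>.\<close>
  define w where "w = (\<lambda>z. W (\<psi> z))"
  have w': "(w has_field_derivative V s) (at (\<phi> s))" if s: "s \<in> ball s1 e" for s
  proof -
    have "(\<psi> has_field_derivative deriv \<psi> (\<phi> s)) (at (\<phi> s))"
      using holomorphic_derivI[OF \<psi>(1) e(3)] s by blast
    moreover have "(W has_field_derivative V s * deriv \<phi> s) (at (\<psi> (\<phi> s)))"
      unfolding \<psi>(3)[OF s] by (rule W'[OF subsetD[OF e(2) s]])
    ultimately have "(w has_field_derivative (V s * deriv \<phi> s) * deriv \<psi> (\<phi> s)) (at (\<phi> s))"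
      unfolding w_def by (rule DERIV_chain2[rotated])
    thus ?thesis
      using \<psi>(2)[OF s] by (simp add: mult.assoc)
  qed
  have germ: "solution_germ F w (\<phi> s1)"
    unfolding solution_germ_def
  proof
    have "w holomorphic_on \<phi> ` ball s1 e"
      unfolding holomorphic_on_open[OF e(3)] using w' by blast
    thus "w analytic_on {\<phi> s1}"
      unfolding analytic_at using e(1,3) by (intro exI[of _ "\<phi> ` ball s1 e"]) auto
    have "\<forall>\<^sub>F z in at (\<phi> s1). z \<in> \<phi> ` ball s1 e"
      using e(1,3) by (intro eventually_at_in_open') auto
    thus "\<forall>\<^sub>F z in at (\<phi> s1). poly2 (ode_at F z) (w z) (deriv w z) = 0"
    proof eventually_elim
      case (elim z)
      then obtain s where s: "s \<in> ball s1 e" "z = \<phi> s"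
        by blast
      have "deriv w z = V s" "w z = W s"
        using DERIV_imp_deriv[OF w'[OF s(1)]] \<psi>(3)[OF s(1)] s(2) by (auto simp: w_def)
      thus ?case
        using F_eq[OF subsetD[OF e(2) s(1)]] s(2) by simp
    qed
  qed
  define \<gamma> where "\<gamma> = \<phi> \<circ> linepath s1 s0"
  have seg: "path_image (linepath s1 s0) \<subseteq> B"
    using s1 B(2,4) by (simp add: closed_segment_subset)
  have "path \<gamma>"
    unfolding \<gamma>_def using seg B(3) holomorphic_on_imp_continuous_on[OF \<phi>(1)]
    by (intro path_continuous_image) (auto intro: continuous_on_subset)
  moreover have "path_image \<gamma> \<inter> S = {}"
    unfolding \<gamma>_def path_image_compose using seg \<phi>_S by auto
  moreover have "pathstart \<gamma> = \<phi> s1"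
    by (simp add: \<gamma>_def pathstart_compose)
  ultimately obtain f where f: "meromorphic_continuation w \<gamma> f"
    using S germ \<phi>_S s1 unfolding critical_points_within_def by blast
  have gen': "deriv \<phi> s \<noteq> 0" if "s \<in> ball s0 (min \<rho> \<rho>') - {s0}" for s
    using gen sub that unfolding B_def[symmetric] by blast
  have \<phi>_B: "\<phi> holomorphic_on ball s0 (min \<rho> \<rho>')"
    using \<phi>(1) B(3) unfolding B_def by (rule holomorphic_on_subset)
  have "\<forall>\<^sub>F s in at s0. f 1 (\<phi> s) = W s"
  proof (rule continuation_pullback[where f = f, OF \<phi>_B gen' W_hol[unfolded B_def]])
    show "s1 \<in> ball s0 (min \<rho> \<rho>')"
      using s1 by (simp add: B_def)
    show "f \<tau> meromorphic_on {\<phi> (linepath s1 s0 \<tau>)}" if "\<tau> \<in> {0..1}" for \<tau>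
      using f that by (simp add: meromorphic_continuation_def \<gamma>_def)
    show "\<forall>\<^sub>F \<tau>' in at \<tau> within {0..1}. \<forall>\<^sub>F z in at (\<phi> (linepath s1 s0 \<tau>')). f \<tau>' z = f \<tau> z"
      if "\<tau> \<in> {0..1}" for \<tau>
      using f that by (simp add: meromorphic_continuation_def \<gamma>_def)
    have "\<forall>\<^sub>F z in at (\<phi> s1). f 0 z = w z"
      using f \<open>pathstart \<gamma> = \<phi> s1\<close> by (simp add: meromorphic_continuation_def)
    moreover have "filterlim \<phi> (at (\<phi> s1)) (at s1)"
      using s1 by (intro filterlim_at_if_deriv_nonzero[OF \<phi>_B gen']) (auto simp: B_def)
    ultimately have "\<forall>\<^sub>F s in at s1. f 0 (\<phi> s) = w (\<phi> s)"
      by (rule eventually_compose_filterlim)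
    moreover have "\<forall>\<^sub>F s in at s1. s \<in> ball s1 e"
      using e(1) by (intro eventually_at_in_open') auto
    ultimately show "\<forall>\<^sub>F s in at s1. f 0 (\<phi> s) = W s"
      by eventually_elim (simp add: w_def \<psi>(3))
  qed
  moreover have lim0: "filterlim \<phi> (at (\<phi> s0)) (at s0)"
    using B(2) by (intro filterlim_at_if_deriv_nonzero[OF \<phi>_B gen']) (auto simp: B_def)
  have "\<forall>\<^sub>F s in at s0. f 1 analytic_on {\<phi> s}"
    using f by (intro eventually_compose_filterlim[OF meromorphic_on_eventually_analytic lim0])
      (auto simp: meromorphic_continuation_def \<gamma>_def linepath_1' dest!: bspec[of _ _ 1])
  moreover have "\<forall>\<^sub>F s in at s0. \<phi> s \<noteq> \<phi> s0"
    using lim0 by (simp add: filterlim_at)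
  moreover have "\<forall>\<^sub>F s in at s0. s \<in> B"
    using B(1,2) by (rule eventually_at_in_open')
  ultimately have "\<forall>\<^sub>F s in at s0. s \<in> B \<and> \<phi> s \<noteq> \<phi> s0 \<and> f 1 analytic_on {\<phi> s} \<and> f 1 (\<phi> s) = W s"
    by eventually_elim auto
  then obtain \<delta> where \<delta>: "0 < \<delta>" "\<And>s. s \<noteq> s0 \<Longrightarrow> dist s s0 < \<delta> \<Longrightarrow>
      s \<in> B \<and> \<phi> s \<noteq> \<phi> s0 \<and> f 1 analytic_on {\<phi> s} \<and> f 1 (\<phi> s) = W s"
    unfolding eventually_at by blast
  have \<delta>': "s \<in> B - {s0}" "\<phi> s \<noteq> \<phi> s0" "f 1 analytic_on {\<phi> s}" "f 1 (\<phi> s) = W s"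
    if "s \<in> ball s0 \<delta> - {s0}" for s
    using \<delta>(2)[of s] that by (auto simp: dist_commute)
  \<comment> \<open>Differentiate \<open>f 1 (\<phi> s) = W s\<close> and cancel the nonzero
    \<open>deriv \<phi> s\<close>; after this \<open>w'\<close> too is a single-valued function of
    \<open>z\<close>.\<close>
  have V_eq: "deriv (f 1) (\<phi> s) = V s" if s: "s \<in> ball s0 \<delta> - {s0}" for s
  proof -
    have "(f 1 has_field_derivative deriv (f 1) (\<phi> s)) (at (\<phi> s))"
      using \<delta>'(3)[OF s] analytic_on_imp_differentiable_at
      by (metis DERIV_deriv_iff_field_differentiable insertI1)
    hence "((\<lambda>s. f 1 (\<phi> s)) has_field_derivative deriv (f 1) (\<phi> s) * deriv \<phi> s) (at s)"
      using \<phi>'[of s] \<delta>'(1)[OF s] by (intro DERIV_chain2[of "f 1"]) auto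
    hence "(W has_field_derivative deriv (f 1) (\<phi> s) * deriv \<phi> s) (at s)"
      by (rule has_field_derivative_transform_within_open[OF _ open_delete[OF open_ball] s])
        (use \<delta>'(4) in blast)
    hence "deriv (f 1) (\<phi> s) * deriv \<phi> s = V s * deriv \<phi> s"
      using DERIV_unique W'[OF \<delta>'(1)[OF s]] by blast
    thus ?thesis
      using gen[OF sub[OF \<delta>'(1)[OF s]]] by simp
  qed
  have T_\<phi>: "T s = H (\<phi> s) (f 1 (\<phi> s)) (deriv (f 1) (\<phi> s))" if "s \<in> ball s0 \<delta> - {s0}" for s
    using T_eq[OF \<delta>'(1)[OF that]] \<delta>'(4)[OF that] V_eq[OF that] by simp
  have "inj_on \<phi> (ball s0 \<delta>)"
  proof (rule inj_onI)
    fix s s' assume s: "s \<in> ball s0 \<delta>" "s' \<in> ball s0 \<delta>" "\<phi> s = \<phi> s'"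
    show "s = s'"
    \<comment> \<open>\<open>T\<close> carries no information at \<open>s0\<close>; this point is
      separated from the others by \<open>\<phi> s \<noteq> \<phi> s0\<close>.\<close>
    proof (cases "s = s0 \<or> s' = s0")
      case True
      thus ?thesis
        using \<delta>'(2)[of s] \<delta>'(2)[of s'] s by (metis DiffI empty_iff insert_iff)
    next
      case False
      hence "T s = T s'"
        using T_\<phi>[of s] T_\<phi>[of s'] s by simp
      thus ?thesis
        using T(2) False s \<delta>'(1) sub by (meson DiffI empty_iff inj_onD insert_iff)
    qed
  qed
  moreover have "\<phi> holomorphic_on ball s0 \<delta>"
    by (rule holomorphic_on_subset[OF \<phi>_B]) (use \<delta>'(1) B(2) in \<open>unfold B_def, blast\<close>)
  ultimately show False
    using holomorphic_injective_imp_regular[OF _ open_ball, of \<phi> s0 \<delta> s0] \<delta>(1) \<phi>(3) by simp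
qed

section \<open>The equation for the parameter\<close>

lemma poly2_monom:
  fixes c :: "'a::comm_ring_1 poly"
  shows "poly2 (monom c n) x y = poly c x * y ^ n"
  by (simp add: poly2_def poly_monom)

lemma poly2_reflect_poly:
  fixes P :: "'a::field poly poly"
  assumes "y \<noteq> 0"
  shows "poly2 (reflect_poly P) x y = y ^ degree P * poly2 P x (inverse y)"
proof (induction P)
  case (pCons c P)
  show ?case
  proof (cases "P = 0")
    case False
    thus ?thesis
      using pCons.IH assms by (simp add: reflect_poly_pCons' poly2_add poly2_monom algebra_simps)
  qed simp
qed simp

lemma generic_polynomial: "N \<noteq> 0 \<Longrightarrow> generic (\<lambda>t z. poly2 N z t \<noteq> 0)"
  by (rule genericI)

text \<open>
  The curve \<open>t = T s\<close>, \<open>z = \<phi> s\<close> solves \<open>dt/dz = P/Q\<close>; at \<open>s0\<close> the function \<open>T\<close> may have a pole.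
\<close>

definition critical_curve :: "complex set \<Rightarrow> complex poly poly \<Rightarrow> complex poly poly \<Rightarrow> complex \<Rightarrow> real \<Rightarrow>
    (complex \<Rightarrow> complex) \<Rightarrow> (complex \<Rightarrow> complex) \<Rightarrow> (complex \<Rightarrow> complex) \<Rightarrow> bool" where
  "critical_curve S P Q s0 \<rho> \<phi> \<phi>' T \<longleftrightarrow> 0 < \<rho> \<and>
    (\<forall>s\<in>ball s0 \<rho>. (\<phi> has_field_derivative \<phi>' s) (at s)) \<and> \<phi> s0 \<notin> S \<and> \<phi>' s0 = 0 \<and>
    T holomorphic_on ball s0 \<rho> - {s0} \<and> inj_on T (ball s0 \<rho> - {s0}) \<and>
    (\<forall>s\<in>ball s0 \<rho> - {s0}. deriv T s * poly2 Q (\<phi> s) (T s) = poly2 P (\<phi> s) (T s) * \<phi>' s)"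

text \<open>\<open>N\<close> collects the zeros of \<open>Q\<close>, the poles of \<open>r1\<close>,
  \<open>r2\<close> and of all coefficients involved, and the zeros of the denominator in the
  inversion formula. What remains is to exhibit a critical curve that leaves \<open>N = 0\<close> at
  once.\<close>

lemma critical_curve_not_generic:
  assumes S: "critical_points_within F S"
    and inv: "invertible_parametrization F r1 r2"
    and R: "deriv_t r1 * Fract P Q = r2 - deriv_z r1" "P \<noteq> 0" "Q \<noteq> 0"
  obtains N where "N \<noteq> 0"
    "\<And>s0 \<rho> \<phi> \<phi>' T. critical_curve S P Q s0 \<rho> \<phi> \<phi>' T \<Longrightarrow>
      \<not> (\<forall>\<^sub>F s in at s0. poly2 N (\<phi> s) (T s) \<noteq> 0)"
proof -
  obtain P1 Q1 where F: "poly2 (map_poly2 embed_z F) r1 r2 = 0"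
    and Q1: "poly2 (map_poly2 embed_z Q1) r1 r2 \<noteq> 0"
    and var_t: "var_t = poly2 (map_poly2 embed_z P1) r1 r2 / poly2 (map_poly2 embed_z Q1) r1 r2"
    using inv unfolding invertible_parametrization_def by blast
  have "generic (\<lambda>t z. poly2 Q z t \<noteq> 0 \<and> ratfun2_regular r1 t z \<and> ratfun2_regular r2 t z \<and>
      (\<forall>i j. ratfun_regular (coeff (coeff F i) j) z) \<and>
      (\<forall>i j. ratfun_regular (coeff (coeff P1 i) j) z) \<and>
      (\<forall>i j. ratfun_regular (coeff (coeff Q1 i) j) z) \<and>
      ratfun2_eval (poly2 (map_poly2 embed_z Q1) r1 r2) t z \<noteq> 0)"
    by (intro generic_conj generic_polynomial generic_regular generic_coeff_coeff_regular
        generic_nonzero R Q1)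
  then obtain N where N: "N \<noteq> 0" "\<And>t z. poly2 N z t \<noteq> 0 \<Longrightarrow>
      poly2 Q z t \<noteq> 0 \<and> ratfun2_regular r1 t z \<and> ratfun2_regular r2 t z \<and>
      (\<forall>i j. ratfun_regular (coeff (coeff F i) j) z) \<and>
      (\<forall>i j. ratfun_regular (coeff (coeff P1 i) j) z) \<and>
      (\<forall>i j. ratfun_regular (coeff (coeff Q1 i) j) z) \<and>
      ratfun2_eval (poly2 (map_poly2 embed_z Q1) r1 r2) t z \<noteq> 0"
    unfolding generic_def by blast
  show ?thesis
  proof (rule that[OF N(1)])
    fix s0 \<rho> \<phi> \<phi>' T
    assume "critical_curve S P Q s0 \<rho> \<phi> \<phi>' T"
    hence \<rho>: "0 < \<rho>"
      and \<phi>': "\<And>s. s \<in> ball s0 \<rho> \<Longrightarrow> (\<phi> has_field_derivative \<phi>' s) (at s)"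
      and \<phi>: "\<phi> s0 \<notin> S" "\<phi>' s0 = 0"
      and T: "T holomorphic_on ball s0 \<rho> - {s0}" "inj_on T (ball s0 \<rho> - {s0})"
      and ode: "\<And>s. s \<in> ball s0 \<rho> - {s0} \<Longrightarrow>
        deriv T s * poly2 Q (\<phi> s) (T s) = poly2 P (\<phi> s) (T s) * \<phi>' s"
      unfolding critical_curve_def by blast+
    show "\<not> (\<forall>\<^sub>F s in at s0. poly2 N (\<phi> s) (T s) \<noteq> 0)"
    proof
      assume "\<forall>\<^sub>F s in at s0. poly2 N (\<phi> s) (T s) \<noteq> 0"
      then obtain d where d: "0 < d" "\<And>s. s \<noteq> s0 \<Longrightarrow> dist s s0 < d \<Longrightarrow> poly2 N (\<phi> s) (T s) \<noteq> 0"
        unfolding eventually_at by blast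
      define e where "e = min \<rho> d"
      have e: "0 < e" "ball s0 e \<subseteq> ball s0 \<rho>" "ball s0 e - {s0} \<subseteq> ball s0 \<rho> - {s0}"
        using \<rho> d(1) by (auto simp: e_def)
      have gen: "poly2 N (\<phi> s) (T s) \<noteq> 0" if "s \<in> ball s0 e - {s0}" for s
        using d(2)[of s] that by (auto simp: e_def dist_commute)
      have deriv: "deriv \<phi> s = \<phi>' s" if "s \<in> ball s0 e" for s
        using DERIV_imp_deriv[OF \<phi>'] that e(2) by blast
      show False
      proof (rule critical_curve_contradiction[OF S F var_t e(1)])
        show "\<phi> holomorphic_on ball s0 e"
          unfolding holomorphic_on_open[OF open_ball] using \<phi>' e(2) by blast
        show "deriv \<phi> s0 = 0"
          using deriv[of s0] \<phi>(2) e(1) by simp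
        show "T holomorphic_on ball s0 e - {s0}" "inj_on T (ball s0 e - {s0})"
          using T e(3) by (auto intro: holomorphic_on_subset inj_on_subset)
        fix s assume s: "s \<in> ball s0 e - {s0}"
        note g = N(2)[OF gen[OF s]]
        have ode_s: "deriv T s * poly2 Q (\<phi> s) (T s) = poly2 P (\<phi> s) (T s) * deriv \<phi> s"
          using ode[of s] deriv[of s] s e(3) by auto
        \<comment> \<open>Injectivity of \<open>T\<close> is exploited here as well: in
          \<open>T' = P \<phi>' / Q\<close> the left side is nonzero, hence so is
          \<open>\<phi>'\<close>.\<close>
        have "deriv T s \<noteq> 0"
          using holomorphic_injective_imp_regular[OF T(1) open_delete[OF open_ball] T(2)] s e(3) by blast
        moreover have "deriv T s = poly2 P (\<phi> s) (T s) * deriv \<phi> s / poly2 Q (\<phi> s) (T s)"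
          using ode_s g by (simp add: nonzero_eq_divide_eq)
        ultimately have "deriv \<phi> s \<noteq> 0"
          by auto
        thus "deriv \<phi> s \<noteq> 0 \<and>
            ratfun2_regular r1 (T s) (\<phi> s) \<and> ratfun2_regular r2 (T s) (\<phi> s) \<and>
            (\<forall>i j. ratfun_regular (coeff (coeff F i) j) (\<phi> s)) \<and>
            (\<forall>i j. ratfun_regular (coeff (coeff P1 i) j) (\<phi> s)) \<and>
            (\<forall>i j. ratfun_regular (coeff (coeff Q1 i) j) (\<phi> s)) \<and>
            ratfun2_eval (poly2 (map_poly2 embed_z Q1) r1 r2) (T s) (\<phi> s) \<noteq> 0"
          using g by blast
        have regular: "ratfun2_regular (Fract P Q) (T s) (\<phi> s)"
          and val: "ratfun2_eval (Fract P Q) (T s) (\<phi> s) = poly2 P (\<phi> s) (T s) / poly2 Q (\<phi> s) (T s)"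
          using g by (auto intro: ratfun2.Fract_regular_val)
        have "ratfun2_eval (deriv_t r1) (T s) (\<phi> s) * ratfun2_eval (Fract P Q) (T s) (\<phi> s)
            = ratfun2_eval r2 (T s) (\<phi> s) - ratfun2_eval (deriv_z r1) (T s) (\<phi> s)"
        proof -
          have "ratfun2_eval (deriv_t r1 * Fract P Q) (T s) (\<phi> s)
              = ratfun2_eval (deriv_t r1) (T s) (\<phi> s) * ratfun2_eval (Fract P Q) (T s) (\<phi> s)"
            by (intro ratfun2.val_mult deriv_regular regular) (use g in blast)
          moreover have "ratfun2_eval (r2 - deriv_z r1) (T s) (\<phi> s)
              = ratfun2_eval r2 (T s) (\<phi> s) - ratfun2_eval (deriv_z r1) (T s) (\<phi> s)"
            by (intro ratfun2.val_diff deriv_regular) (use g in blast)+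
          ultimately show ?thesis
            unfolding R(1) by (rule trans[OF sym])
        qed
        hence "ratfun2_eval r2 (T s) (\<phi> s) - ratfun2_eval (deriv_z r1) (T s) (\<phi> s)
            = ratfun2_eval (deriv_t r1) (T s) (\<phi> s) * (poly2 P (\<phi> s) (T s) / poly2 Q (\<phi> s) (T s))"
          by (simp add: val)
        thus "ratfun2_eval (deriv_t r1) (T s) (\<phi> s) * deriv T s
            = (ratfun2_eval r2 (T s) (\<phi> s) - ratfun2_eval (deriv_z r1) (T s) (\<phi> s)) * deriv \<phi> s"
          using \<open>deriv T s = _\<close> by simp
      qed (use \<phi>(1) in auto)
    qed
  qed
qed

lemma exists_common_nonroot:
  fixes c d :: "complex poly"
  assumes "finite S" "c \<noteq> 0" "d \<noteq> 0"
  obtains z where "z \<notin> S" "poly c z \<noteq> 0" "poly d z \<noteq> 0"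
proof -
  have "finite (S \<union> {z. poly c z = 0} \<union> {z. poly d z = 0})"
    using assms by (simp add: poly_roots_finite)
  hence "\<exists>z. z \<notin> S \<union> {z. poly c z = 0} \<union> {z. poly d z = 0}"
    using infinite_UNIV_char_0 by (metis ex_new_if_finite)
  thus ?thesis
    using that by auto
qed

text \<open>
  At a zero \<open>t0\<close> of the denominator of \<open>dt/dz\<close> the reciprocal equation for \<open>z\<close> as a function of
  \<open>t\<close> has a solution with a critical point.
\<close>

lemma denominator_constant:
  assumes S: "critical_points_within F S"
    and inv: "invertible_parametrization F r1 r2"
    and R: "deriv_t r1 * Fract P Q = r2 - deriv_z r1" "P \<noteq> 0" "Q \<noteq> 0" "coprime P Q"
  shows "degree Q = 0"
proof (rule ccontr)
  assume deg: "degree Q \<noteq> 0"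
  have finite: "finite S"
    using S by (simp add: critical_points_within_def)
  obtain N where N: "N \<noteq> 0"
    "\<And>s0 \<rho> \<phi> \<phi>' T. critical_curve S P Q s0 \<rho> \<phi> \<phi>' T \<Longrightarrow>
      \<not> (\<forall>\<^sub>F s in at s0. poly2 N (\<phi> s) (T s) \<noteq> 0)"
    using critical_curve_not_generic[OF S inv R(1-3)] by blast
  obtain c where c: "c \<noteq> 0"
    "\<And>\<phi> t0 \<rho>. 0 < \<rho> \<Longrightarrow> \<phi> holomorphic_on ball t0 \<rho> \<Longrightarrow> poly c (\<phi> t0) \<noteq> 0 \<Longrightarrow> deriv \<phi> t0 = 0 \<Longrightarrow>
      (\<forall>\<^sub>F s in at t0. poly2 N (\<phi> s) s \<noteq> 0)"
    by (rule transversality[OF N(1)]) (rule that)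
  obtain a b d where d: "d \<noteq> 0" "a * P + b * Q = [:d:]"
    by (rule coprime_bezout_const[OF R(4,2)])
  \<comment> \<open>\<open>c\<close> ensures transversality to \<open>N = 0\<close>,
    \<open>d\<close> excludes common zeros of \<open>P\<close> and \<open>Q\<close> over
    \<open>z0\<close>, and the leading coefficient keeps \<open>Q\<close> nonconstant in
    \<open>t\<close> at \<open>z0\<close>, so that it has a zero.\<close>
  obtain z0 where z0: "z0 \<notin> S" "poly (c * d) z0 \<noteq> 0" "poly (lead_coeff Q) z0 \<noteq> 0"
    by (rule exists_common_nonroot[OF finite, of "c * d" "lead_coeff Q"]) (use c(1) d(1) R(3) in auto)
  define q where "q = map_poly (\<lambda>p. poly p z0) Q"
  have "coeff q (degree Q) \<noteq> 0"
    using z0(3) by (simp add: q_def coeff_map_poly)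
  hence "degree q \<noteq> 0"
    using le_degree deg by fastforce
  hence "\<not> constant (poly q)"
    by (simp add: constant_degree)
  then obtain t0 where "poly q t0 = 0"
    using fundamental_theorem_of_algebra by blast
  hence Q0: "poly2 Q z0 t0 = 0"
    by (simp add: q_def poly2_eq_poly_map_poly)
  have "poly2 (a * P + b * Q) z0 t0 \<noteq> 0"
    unfolding d(2) using z0(2) by simp
  hence P0: "poly2 P z0 t0 \<noteq> 0"
    using Q0 by (auto simp: poly2_add poly2_mult)
  obtain \<rho> \<phi> where \<phi>: "0 < \<rho>" "\<phi> t0 = z0"
    "\<And>s. s \<in> ball t0 \<rho> \<Longrightarrow> poly2 P (\<phi> s) s \<noteq> 0"
    "\<And>s. s \<in> ball t0 \<rho> \<Longrightarrow> (\<phi> has_field_derivative poly2 Q (\<phi> s) s / poly2 P (\<phi> s) s) (at s)"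
    using rational_ode_solution[OF P0] by blast
  show False
  proof (rule N(2)[THEN notE])
    show "critical_curve S P Q t0 \<rho> \<phi> (\<lambda>s. poly2 Q (\<phi> s) s / poly2 P (\<phi> s) s) (\<lambda>s. s)"
      unfolding critical_curve_def using \<phi> z0(1) Q0 by (auto intro: holomorphic_intros)
    show "\<forall>\<^sub>F s in at t0. poly2 N (\<phi> s) s \<noteq> 0"
    proof (rule c(2)[OF \<phi>(1)])
      show "\<phi> holomorphic_on ball t0 \<rho>"
        unfolding holomorphic_on_open[OF open_ball] using \<phi>(4) by blast
      show "poly c (\<phi> t0) \<noteq> 0"
        using z0(2) \<phi>(2) by simp
      show "deriv \<phi> t0 = 0"
        using DERIV_imp_deriv[OF \<phi>(4)[of t0]] \<phi>(1,2) Q0 by simp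
    qed
  qed
qed

text \<open>
  If the right-hand side is a polynomial of degree \<open>d > 2\<close> in \<open>t\<close>, then, in terms of \<open>s = 1/t\<close>,
  the derivative \<open>dz/ds\<close> has a zero of order \<open>d - 2\<close> at \<open>s = 0\<close>.
\<close>

lemma numerator_degree_le_2:
  assumes S: "critical_points_within F S"
    and inv: "invertible_parametrization F r1 r2"
    and R: "deriv_t r1 * Fract P [:q:] = r2 - deriv_z r1" "q \<noteq> 0"
  shows "degree P \<le> 2"
proof (rule ccontr)
  assume deg: "\<not> degree P \<le> 2"
  hence "P \<noteq> 0"
    by auto
  have "[:q:] \<noteq> 0"
    using R(2) by simp
  define d where "d = degree P"
  \<comment> \<open>A positive exponent \<open>d - 2\<close> is what makes \<open>dz/ds\<close>
    vanish at \<open>s = 0\<close>.\<close>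
  have d: "d = Suc (Suc (d - 2))" "d - 2 \<noteq> 0"
    using deg by (auto simp: d_def)
  have finite: "finite S"
    using S by (simp add: critical_points_within_def)
  obtain N where N: "N \<noteq> 0"
    "\<And>s0 \<rho> \<phi> \<phi>' T. critical_curve S P [:q:] s0 \<rho> \<phi> \<phi>' T \<Longrightarrow>
      \<not> (\<forall>\<^sub>F s in at s0. poly2 N (\<phi> s) (T s) \<noteq> 0)"
    using critical_curve_not_generic[OF S inv R(1) \<open>P \<noteq> 0\<close> \<open>[:q:] \<noteq> 0\<close>] by blast
  obtain z0 where z0: "z0 \<notin> S" "poly (lead_coeff N) z0 \<noteq> 0" "poly (lead_coeff P) z0 \<noteq> 0"
    by (rule exists_common_nonroot[OF finite, of "lead_coeff N" "lead_coeff P"])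
      (use N(1) \<open>P \<noteq> 0\<close> in auto)
  \<comment> \<open>The value at \<open>t = \<infinity>\<close> is the leading coefficient. Since
    that of \<open>N\<close> is nonzero at \<open>z0\<close>, the curve \<open>N = 0\<close> is
    avoided by continuity, with no transversality argument.\<close>
  have reflect_0: "poly2 (reflect_poly M) z 0 = poly (lead_coeff M) z" for M :: "complex poly poly" and z
    by (cases M rule: pCons_cases; simp add: poly2_def poly_0_coeff_0)
  \<comment> \<open>Under \<open>t = 1/s\<close>, \<open>dz/dt = q/P\<close> becomes
    \<open>dz/ds = - q / (s^2 P(1/s))\<close>; multiplying numerator and denominator by
    \<open>s^(d-2)\<close> turns the denominator into the reflected polynomial
    \<open>s^d P(1/s)\<close>.\<close>
  obtain \<rho> \<phi> where \<phi>: "0 < \<rho>" "\<phi> 0 = z0"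
    "\<And>s. s \<in> ball 0 \<rho> \<Longrightarrow> poly2 (reflect_poly P) (\<phi> s) s \<noteq> 0"
    "\<And>s. s \<in> ball 0 \<rho> \<Longrightarrow> (\<phi> has_field_derivative
        poly2 (monom (- q) (d - 2)) (\<phi> s) s / poly2 (reflect_poly P) (\<phi> s) s) (at s)"
    using rational_ode_solution[of "reflect_poly P" z0 0] z0(3) by (metis reflect_0)
  have ode: "deriv inverse s * poly2 [:q:] (\<phi> s) (inverse s) = poly2 P (\<phi> s) (inverse s) *
      (poly2 (monom (- q) (d - 2)) (\<phi> s) s / poly2 (reflect_poly P) (\<phi> s) s)"
    if "s \<in> ball 0 \<rho> - {0}" for s
  proof -
    have s: "s \<noteq> 0" "poly2 P (\<phi> s) (inverse s) \<noteq> 0"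
      using \<phi>(3)[of s] that by (auto simp: poly2_reflect_poly)
    have "deriv inverse s = - (inverse s ^ Suc (Suc 0))"
      by (rule DERIV_imp_deriv[OF DERIV_inverse[OF s(1)]])
    moreover have "s ^ d = s ^ (d - 2) * (s * s)"
      by (subst d(1)) simp
    ultimately show ?thesis
      using s by (simp add: poly2_monom poly2_reflect_poly d_def[symmetric] divide_simps)
  qed
  have "isCont (\<lambda>s. poly2 (reflect_poly N) (\<phi> s) s) 0"
    by (rule DERIV_isCont[OF poly2_has_field_derivative[OF \<phi>(4) DERIV_ident]]) (use \<phi>(1) in simp)
  moreover have "poly2 (reflect_poly N) (\<phi> 0) 0 \<noteq> 0"
    using z0(2) \<phi>(2) by (simp add: reflect_0)
  ultimately have "\<forall>\<^sub>F s in at 0. poly2 (reflect_poly N) (\<phi> s) s \<noteq> 0"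
    unfolding isCont_def by (rule tendsto_imp_eventually_ne)
  moreover have "\<forall>\<^sub>F s in at 0. s \<noteq> (0 :: complex)"
    by (simp add: eventually_neq_at_within)
  ultimately have "\<forall>\<^sub>F s in at 0. poly2 N (\<phi> s) (inverse s) \<noteq> 0"
    by eventually_elim (auto simp: poly2_reflect_poly)
  moreover have "critical_curve S P [:q:] 0 \<rho> \<phi>
      (\<lambda>s. poly2 (monom (- q) (d - 2)) (\<phi> s) s / poly2 (reflect_poly P) (\<phi> s) s) inverse"
    unfolding critical_curve_def
    using \<phi>(1,4) ode z0(1) \<phi>(2) d(2) by (auto simp: poly2_monom intro!: holomorphic_intros inj_onI)
  ultimately show False
    using N(2) by blast
qed

lemma parameter_equation_quadratic:
  assumes "no_movable_critical_point F" "invertible_parametrization F r1 r2" "deriv_t r1 \<noteq> 0"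
  obtains A B C where
    "(r2 - deriv_z r1) / deriv_t r1 = embed_z A * var_t ^ 2 + embed_z B * var_t + embed_z C"
proof -
  define R where "R = (r2 - deriv_z r1) / deriv_t r1"
  define P Q where "P = fst (quot_of_fract R)" and "Q = snd (quot_of_fract R)"
  have R: "R = Fract P Q" "Q \<noteq> 0" "coprime P Q"
    by (simp_all add: P_def Q_def coprime_quot_of_fract)
  have eq: "deriv_t r1 * Fract P Q = r2 - deriv_z r1"
    using assms(3) unfolding R(1)[symmetric] by (simp add: R_def)
  show ?thesis
  \<comment> \<open>The reciprocal equation makes sense only for \<open>P \<noteq> 0\<close>; a zero
    right-hand side is already quadratic.\<close>
  proof (cases "P = 0")
    case True
    hence "R = embed_z 0 * var_t ^ 2 + embed_z 0 * var_t + embed_z 0"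
      using R by (simp add: fract_collapse)
    thus ?thesis
      using that unfolding R_def by blast
  next
    case False
    obtain S where S: "critical_points_within F S"
      using assms(1) unfolding no_movable_critical_point_def critical_points_within_def by blast
    have "degree Q = 0"
      by (rule denominator_constant[OF S assms(2) eq False R(2,3)])
    then obtain q where q: "Q = [:q:]"
      by (rule degree_eq_zeroE)
    have "q \<noteq> 0"
      using R(2) q by simp
    have "degree P \<le> 2"
      by (rule numerator_degree_le_2[OF S assms(2) eq[unfolded q] \<open>q \<noteq> 0\<close>])
    hence P: "P = [:coeff P 0, coeff P 1, coeff P 2:]"
      by (intro poly_eqI) (auto simp: coeff_pCons numeral_2_eq_2 coeff_eq_0 split: nat.split)
    have "R = Fract [:coeff P 0, coeff P 1, coeff P 2:] [:q:]"
      using R(1) q P by simp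
    thus ?thesis
      using that unfolding R_def quadratic_Fract[OF \<open>q \<noteq> 0\<close>] by blast
  qed
qed

section \<open>Changes of variables\<close>

text \<open>By the chain rule \<open>w'\<close> is the \<open>t\<close>-derivative of
  \<open>r1\<close> times \<open>t'\<close> plus its \<open>z\<close>-derivative, and the first
  factor is nonzero at the point, so the condition \<open>w' = r2\<close> can be solved for
  \<open>t'\<close>.\<close>

lemma parameter_substitution:
  assumes R: "deriv_t r1 \<noteq> 0"
      "(r2 - deriv_z r1) / deriv_t r1 = embed_z A * var_t ^ 2 + embed_z B * var_t + embed_z C"
    and U: "open U" "t holomorphic_on U" "z \<in> U" "\<And>z. z \<in> U \<Longrightarrow> w z = ratfun2_eval r1 (t z) z"
    and reg: "ratfun2_regular r1 (t z) z" "ratfun2_regular r2 (t z) z"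
      "ratfun2_eval (deriv_t r1) (t z) z \<noteq> 0"
      "ratfun_regular A z" "ratfun_regular B z" "ratfun_regular C z"
  shows "deriv w z = ratfun2_eval r2 (t z) z \<longleftrightarrow>
    deriv t z = ratfun_eval A z * t z ^ 2 + ratfun_eval B z * t z + ratfun_eval C z"
proof -
  have "(t has_field_derivative deriv t z) (at z)"
    by (rule holomorphic_derivI[OF U(2,1,3)])
  hence "((\<lambda>z. ratfun2_eval r1 (t z) z) has_field_derivative
      ratfun2_eval (deriv_t r1) (t z) z * deriv t z + ratfun2_eval (deriv_z r1) (t z) z * 1) (at z)"
    by (intro ratfun2_eval_has_field_derivative reg(1) DERIV_ident)
  hence "(w has_field_derivative
      ratfun2_eval (deriv_t r1) (t z) z * deriv t z + ratfun2_eval (deriv_z r1) (t z) z * 1) (at z)"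
    by (rule has_field_derivative_transform_within_open[OF _ U(1,3)]) (simp add: U(4))
  hence w': "deriv w z = ratfun2_eval (deriv_t r1) (t z) z * deriv t z + ratfun2_eval (deriv_z r1) (t z) z"
    by (simp add: DERIV_imp_deriv)
  have "deriv_t r1 * (embed_z A * var_t ^ 2 + embed_z B * var_t + embed_z C) = r2 - deriv_z r1"
    unfolding R(2)[symmetric] using R(1) by simp
  from arg_cong[OF this, of "\<lambda>q. ratfun2_eval q (t z) z"]
  have "ratfun2_eval (deriv_t r1) (t z) z * (ratfun_eval A z * t z ^ 2 + ratfun_eval B z * t z + ratfun_eval C z)
      = ratfun2_eval r2 (t z) z - ratfun2_eval (deriv_z r1) (t z) z"
    using reg by (simp add: ratfun2.val_mult ratfun2.val_add ratfun2.val_diff ratfun2.val_power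
        embed_z_regular_eval var_t_regular_eval deriv_regular)
  hence "ratfun2_eval r2 (t z) z = ratfun2_eval (deriv_t r1) (t z) z *
      (ratfun_eval A z * t z ^ 2 + ratfun_eval B z * t z + ratfun_eval C z) + ratfun2_eval (deriv_z r1) (t z) z"
    by (simp add: algebra_simps)
  thus ?thesis
    unfolding w' using reg(3) by simp
qed

text \<open>With \<open>t = -u/A\<close> the equation becomes
  \<open>u' + u^2 = (B + A'/A) u - A C\<close>. Completing the square takes half of the linear
  coefficient as \<open>\<beta>\<close>, and \<open>\<beta>^2 - A C - \<beta>'\<close> is left over
  as \<open>r\<close>. The fraction \<open>Fract [:1/2:] 1\<close> is the constant 1/2.\<close>

lemma riccati_normal_form:
  fixes A B C :: "complex poly fract"
  assumes \<beta>: "\<beta> = (B + fract_derivation pderiv A / A) * Fract [:1/2:] 1"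
    and r: "r = \<beta> ^ 2 - A * C - fract_derivation pderiv \<beta>"
    and U: "open U" "u holomorphic_on U" "v holomorphic_on U" "z \<in> U"
      "\<And>z. z \<in> U \<Longrightarrow> t z = - u z / ratfun_eval A z" "\<And>z. z \<in> U \<Longrightarrow> u z = v z + ratfun_eval \<beta> z"
    and reg: "ratfun_regular A z" "ratfun_regular B z" "ratfun_regular C z" "ratfun_regular \<beta> z"
      "ratfun_eval A z \<noteq> 0"
  shows "deriv t z = ratfun_eval A z * t z ^ 2 + ratfun_eval B z * t z + ratfun_eval C z \<longleftrightarrow>
    deriv v z + v z ^ 2 = ratfun_eval r z"
proof -
  define a a' b c \<beta>z \<beta>' where "a = ratfun_eval A z" and "a' = ratfun_eval (fract_derivation pderiv A) z"
    and "b = ratfun_eval B z" and "c = ratfun_eval C z"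
    and "\<beta>z = ratfun_eval \<beta> z" and "\<beta>' = ratfun_eval (fract_derivation pderiv \<beta>) z"
  note vals = a_def[symmetric] a'_def[symmetric] b_def[symmetric] c_def[symmetric]
    \<beta>z_def[symmetric] \<beta>'_def[symmetric]
  have a: "a \<noteq> 0"
    using reg(5) by (simp add: a_def)
  define X where "X = a' / a"
  have half: "ratfun_regular (Fract [:1/2:] 1) z" "ratfun_eval (Fract [:1/2:] 1) z = 1 / 2"
    using ratfun.Fract_regular_val[of 1 z "[:1/2:]"] by simp_all
  have "\<beta>z = (b + X) * (1 / 2)"
    unfolding \<beta>z_def \<beta>
    using reg by (simp add: ratfun.val_mult ratfun.val_add ratfun.val_divide half
        ratfun_eval_has_field_derivative(1) X_def vals)
  \<comment> \<open>In this form the choice of \<open>\<beta>\<close> makes the terms linear in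
    \<open>v\<close> cancel.\<close>
  hence X: "X = 2 * \<beta>z - b"
    by (simp add: algebra_simps)
  have r_eq: "ratfun_eval r z = \<beta>z ^ 2 - a * c - \<beta>'"
    unfolding r using reg by (simp add: ratfun.val_diff ratfun.val_power ratfun.val_mult
        ratfun_eval_has_field_derivative(1) vals)
  have "(v has_field_derivative deriv v z) (at z)"
    by (rule holomorphic_derivI[OF U(3,1,4)])
  hence "((\<lambda>z. v z + ratfun_eval \<beta> z) has_field_derivative deriv v z + \<beta>') (at z)"
    unfolding \<beta>'_def by (intro DERIV_add ratfun_eval_has_field_derivative reg)
  hence "(u has_field_derivative deriv v z + \<beta>') (at z)"
    by (rule has_field_derivative_transform_within_open[OF _ U(1,4)]) (simp add: U(6))
  hence "((\<lambda>z. - u z / ratfun_eval A z) has_field_derivative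
      (- (deriv v z + \<beta>') * a - (- u z) * a') / (a * a)) (at z)"
    unfolding a_def a'_def
    by (intro DERIV_divide DERIV_minus ratfun_eval_has_field_derivative reg)
  hence "(t has_field_derivative (- (deriv v z + \<beta>') * a - (- u z) * a') / (a * a)) (at z)"
    by (rule has_field_derivative_transform_within_open[OF _ U(1,4)]) (simp add: U(5))
  hence "deriv t z = (- (deriv v z + \<beta>') * a - (- u z) * a') / (a * a)"
    by (rule DERIV_imp_deriv)
  also have "\<dots> = (u z * X - (deriv v z + \<beta>')) / a"
    using a by (simp add: X_def field_simps)
  finally have t': "deriv t z = (u z * X - (deriv v z + \<beta>')) / a" .
  have t: "t z = - u z / a"
    using U(4,5) by (simp add: a_def)
  have u: "u z = v z + \<beta>z"
    using U(4,6) by (simp add: \<beta>z_def)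
  have rhs: "a * t z ^ 2 + b * t z + c = (u z ^ 2 - b * u z + a * c) / a"
    unfolding t using a by (simp add: field_simps power2_eq_square)
  have "deriv t z = a * t z ^ 2 + b * t z + c \<longleftrightarrow>
      u z * X - (deriv v z + \<beta>') = u z ^ 2 - b * u z + a * c"
    unfolding t' rhs using a by (simp only: divide_cancel_right) simp
  also have "\<dots> \<longleftrightarrow> deriv v z + v z ^ 2 = \<beta>z ^ 2 - a * c - \<beta>'"
    unfolding X u by (simp add: algebra_simps power2_eq_square) (auto simp: algebra_simps)
  finally show ?thesis
    unfolding vals r_eq .
qed

text \<open>The Riccati form is an identity between rational functions. The changes of variables are
  rendered as equivalences between equations for functions on open sets; both hold point by point,
  openness serving to differentiate the substitutions.\<close>

theorem mainTheorem2:
  fixes F :: "complex poly fract poly poly"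
    and r1 r2 :: "complex poly poly fract"
  assumes "irreducible F"
    and "first_order F"
    and "has_algebraic_genus F 0"
    and "no_movable_critical_point F"
    and "invertible_parametrization F r1 r2"
  shows "\<exists>A B C :: complex poly fract.
    deriv_t r1 \<noteq> 0 \<and>
    (r2 - deriv_z r1) / deriv_t r1 = embed_z A * var_t ^ 2 + embed_z B * var_t + embed_z C \<and>
    (\<forall>U t w. open U \<and> t holomorphic_on U \<and>
        (\<forall>z\<in>U. ratfun2_regular r1 (t z) z \<and> ratfun2_regular r2 (t z) z \<and>
               ratfun2_eval (deriv_t r1) (t z) z \<noteq> 0 \<and>
               ratfun_regular A z \<and> ratfun_regular B z \<and> ratfun_regular C z) \<and>
        (\<forall>z\<in>U. w z = ratfun2_eval r1 (t z) z)
      \<longrightarrow> ((\<forall>z\<in>U. deriv w z = ratfun2_eval r2 (t z) z) \<longleftrightarrow>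
           (\<forall>z\<in>U. deriv t z =
              ratfun_eval A z * t z ^ 2 + ratfun_eval B z * t z + ratfun_eval C z))) \<and>
    (A \<noteq> 0 \<longrightarrow>
      (\<exists>\<beta> r :: complex poly fract.
        \<forall>U t u v. open U \<and> t holomorphic_on U \<and> u holomorphic_on U \<and> v holomorphic_on U \<and>
            (\<forall>z\<in>U. ratfun_regular A z \<and> ratfun_regular B z \<and> ratfun_regular C z \<and>
                   ratfun_regular \<beta> z \<and> ratfun_regular r z \<and> ratfun_eval A z \<noteq> 0) \<and>
            (\<forall>z\<in>U. t z = - u z / ratfun_eval A z \<and> u z = v z + ratfun_eval \<beta> z)
          \<longrightarrow> ((\<forall>z\<in>U. deriv t z =
                  ratfun_eval A z * t z ^ 2 + ratfun_eval B z * t z + ratfun_eval C z) \<longleftrightarrow>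
               (\<forall>z\<in>U. deriv v z + v z ^ 2 = ratfun_eval r z)))) \<and>
    (A = 0 \<longrightarrow>
      (r2 - deriv_z r1) / deriv_t r1 = embed_z B * var_t + embed_z C)"
proof -
  have r1: "deriv_t r1 \<noteq> 0"
    by (rule deriv_t_parametrization_nonzero[OF assms(1,2,5)])
  obtain A B C where R:
    "(r2 - deriv_z r1) / deriv_t r1 = embed_z A * var_t ^ 2 + embed_z B * var_t + embed_z C"
    using parameter_equation_quadratic[OF assms(4,5) r1] by blast
  define \<beta> where "\<beta> = (B + fract_derivation pderiv A / A) * Fract [:1/2:] 1"
  define r where "r = \<beta> ^ 2 - A * C - fract_derivation pderiv \<beta>"
  show ?thesis
  proof (rule exI[of _ A], rule exI[of _ B], rule exI[of _ C], intro conjI impI)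
    show "deriv_t r1 \<noteq> 0"
      by (rule r1)
    show "(r2 - deriv_z r1) / deriv_t r1 = embed_z A * var_t ^ 2 + embed_z B * var_t + embed_z C"
      by (rule R)
    show "(r2 - deriv_z r1) / deriv_t r1 = embed_z B * var_t + embed_z C" if "A = 0"
      using R that by simp
    show "\<forall>U t w. open U \<and> t holomorphic_on U \<and>
        (\<forall>z\<in>U. ratfun2_regular r1 (t z) z \<and> ratfun2_regular r2 (t z) z \<and>
               ratfun2_eval (deriv_t r1) (t z) z \<noteq> 0 \<and>
               ratfun_regular A z \<and> ratfun_regular B z \<and> ratfun_regular C z) \<and>
        (\<forall>z\<in>U. w z = ratfun2_eval r1 (t z) z)
      \<longrightarrow> ((\<forall>z\<in>U. deriv w z = ratfun2_eval r2 (t z) z) \<longleftrightarrow>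
           (\<forall>z\<in>U. deriv t z =
              ratfun_eval A z * t z ^ 2 + ratfun_eval B z * t z + ratfun_eval C z))"
    proof (intro allI impI ball_cong refl)
      fix U t w z
      assume U: "open U \<and> t holomorphic_on U \<and>
        (\<forall>z\<in>U. ratfun2_regular r1 (t z) z \<and> ratfun2_regular r2 (t z) z \<and>
               ratfun2_eval (deriv_t r1) (t z) z \<noteq> 0 \<and>
               ratfun_regular A z \<and> ratfun_regular B z \<and> ratfun_regular C z) \<and>
        (\<forall>z\<in>U. w z = ratfun2_eval r1 (t z) z)" and z: "z \<in> U"
      show "deriv w z = ratfun2_eval r2 (t z) z \<longleftrightarrow>
          deriv t z = ratfun_eval A z * t z ^ 2 + ratfun_eval B z * t z + ratfun_eval C z"
        by (rule parameter_substitution[OF r1 R, of U]) (use U z in blast)+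
    qed
    show "\<exists>\<beta> r :: complex poly fract.
        \<forall>U t u v. open U \<and> t holomorphic_on U \<and> u holomorphic_on U \<and> v holomorphic_on U \<and>
            (\<forall>z\<in>U. ratfun_regular A z \<and> ratfun_regular B z \<and> ratfun_regular C z \<and>
                   ratfun_regular \<beta> z \<and> ratfun_regular r z \<and> ratfun_eval A z \<noteq> 0) \<and>
            (\<forall>z\<in>U. t z = - u z / ratfun_eval A z \<and> u z = v z + ratfun_eval \<beta> z)
          \<longrightarrow> ((\<forall>z\<in>U. deriv t z =
                  ratfun_eval A z * t z ^ 2 + ratfun_eval B z * t z + ratfun_eval C z) \<longleftrightarrow>
               (\<forall>z\<in>U. deriv v z + v z ^ 2 = ratfun_eval r z))"
    proof (rule exI[of _ \<beta>], rule exI[of _ r], intro allI impI ball_cong refl)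
      fix U t u v z
      assume U: "open U \<and> t holomorphic_on U \<and> u holomorphic_on U \<and> v holomorphic_on U \<and>
            (\<forall>z\<in>U. ratfun_regular A z \<and> ratfun_regular B z \<and> ratfun_regular C z \<and>
                   ratfun_regular \<beta> z \<and> ratfun_regular r z \<and> ratfun_eval A z \<noteq> 0) \<and>
            (\<forall>z\<in>U. t z = - u z / ratfun_eval A z \<and> u z = v z + ratfun_eval \<beta> z)" and z: "z \<in> U"
      show "deriv t z = ratfun_eval A z * t z ^ 2 + ratfun_eval B z * t z + ratfun_eval C z \<longleftrightarrow>
          deriv v z + v z ^ 2 = ratfun_eval r z"
        by (rule riccati_normal_form[OF \<beta>_def r_def, of U u]) (use U z in blast)+
    qed
  qed
qed

end
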